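(* Let $A=\bigoplus_{r\in\mathbb Q}A_rX^r$ be an additive subgroup of $K[\mathbb Q,\sigma]$ with $A_0=V$, $W_r=O_l(A_r)$, $W=\bigcup_{r\in\mathbb Q}W_r$, and $J(W)=Wb^{-1}$ for some $b\in K$. Assume that there is a $t\in\mathbb Q$ with $O_l(A_t)=W$. Also assume that either $l_m<+\infty$ or $k_m<+\infty$ for some $m\in\mathbb Q^+$ (a condition on $A$ when $A$ is a graded extension of Type (e), which is when $l_m,k_m$ are defined). Then $A$ is a graded extension of $V$ in $K[\mathbb Q,\sigma]$ of Type (e) if and only if the following properties hold: (1) There are a nonzero graded map $f:\mathbb Q\to\mathbb Z$ and, for every $r\in\mathbb Q$, an element $\alpha_r\in K$, with $\alpha_0=1$, such that for all $r,s\in\mathbb Q$: $WA_r=Wb^{f(r)}\alpha_r$, $W\alpha_r=\alpha_rW^{\sigma(r)}$, and $(W\alpha_r)(W\alpha_s)^{\sigma(r)}=W\alpha_r\alpha_s^{\sigma(r)}=W\alpha_{r+s}$. (2)(a) If either $W=V$, or $f(r)+f(-r)=-1$ for every $r\neq0$, then $A_r=Wb^{f(r)}\alpha_r$ for every $r\ne0$. (2)(b) If $W\neq V$ and there is a $k\in\mathbb Q^+$ with $f(k)+f(-k)=0$ (let $k$ be the smallest positive rational number with this property), then $A_r=Wb^{f(r)}\alpha_r$ for all $r\notin k\mathbb Z$, and $B=\bigoplus_{j\in\mathbb Z}A_{jk}X^{jk}$ is a graded extension of $V$ in $K[X^k,X^{-k};\sigma(k)]$ with $Wb^{f(jk)-1}\alpha_{jk}\subset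 A_{jk}\subset Wb^{f(jk)}\alpha_{jk}$ for all $j\in\mathbb Z$.
   Context: $K$ is a division ring and $V$ is a total valuation ring of $K$ (a subring such that for every nonzero $k\in K$, $k\in V$ or $k^{-1}\in V$), with $V\neq K$. $\sigma:\mathbb Q\to \mathrm{Aut}(K)$ is a homomorphism from the additive group $\mathbb Q$. For $a\in K$, $I\subseteq K$, $g\in\mathbb Q$ write $a^{\sigma(g)}=\sigma(g)(a)$, $I^{\sigma(g)}=\sigma(g)(I)$. For a nonzero subgroup $G\subseteq\mathbb Q$, $K[G,\sigma]=\bigoplus_{g\in G}KX^g$ is the skew group ring, with $X^ga=a^{\sigma(g)}X^g$ and $X^gX^h=X^{g+h}$. A graded subring $A=\bigoplus_{g\in G}A_gX^g$ of $K[G,\sigma]$ is a graded total valuation ring if for every nonzero homogeneous element $aX^g$, $aX^g\in A$ or $(aX^g)^{-1}\in A$; it is a graded extension of $V$ in $K[G,\sigma]$ if moreover $A_0=V$. For $g>0$ in $\mathbb Q$, $K[X^g,X^{-g};\sigma(g)]$ denotes $K[\mathbb Zg,\sigma|_{\mathbb Zg}]$. Products of additive subgroups of $K$ are the additive subgroups generated by products of elements; $\subset$ denotes proper inclusion; $\mathbb N=\{1,2,\dots\}$; $\mathbb Q^+$ is the set of positive rationals; $J(\cdot)$ denotes the Jacobson radical; $O_l(I)=\{a\in K\mid aI\subseteq I\}$. Writing $J(W)$ presupposes that $W$ is a ring. A graded extension $\bigoplus_{g\in G}A_gX^g$ of $V$ in $K[G,\sigma]$ is of Type (II) if for some $g,h\in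 G$ with $g,h>0$, $A_gA_h^{\sigma(g)}\ne A_{g+h}$ or $A_{-g}(A_{-h})^{\sigma(-g)}\neq A_{-g-h}$. A graded extension $A=\bigoplus_{r\in\mathbb Q}A_rX^r$ of $V$ in $K[\mathbb Q,\sigma]$, with $W=\bigcup_{s\in\mathbb Q}O_l(A_s)$, is of Type (e) if there is a rational $r>0$ such that $H_r=\bigoplus_{i\in\mathbb Z}A_{ir}X^{ir}$ is a graded extension of $V$ of Type (II) in $K[X^r,X^{-r};\sigma(r)]$, and $J(W)=b^{-1}W$ for some $b\in K$. For $g>0$, a graded extension $\bigoplus_{i\in\mathbb Z}A_{ig}X^{ig}$ of $V$ in $K[X^g,X^{-g};\sigma(g)]$ is of Type (e) if, with $U=O_l(A_g)$, one has $A_g=Ua=aU^{\sigma(g)}$ and $A_{-g}=J(U)(a^{-1})^{\sigma(-g)}$ for some $a\in K$, and $J(U)=Uc^{-1}$ for some $c\in K$. For a nonzero additive subgroup $G\subseteq\mathbb Q$, a map $f:G\to\mathbb Z$ is a graded map if $f(0)=0$, $f(s)+f(t)\le f(s+t)$ and $f(s)+f(-s)\ge-1$ for all $s,t\in G$. For $r>0$, a graded map $f:\mathbb Zr\to\mathbb Z$ is a nice map if $f(r)=0$ and $f(-r)=-1$. Definition of $l_r$ and $k_r$. Let $A$ be a graded extension of $V$ in $K[\mathbb Q,\sigma]$ of Type (e) with $J(W)=b^{-1}W$ and with $O_l(A_t)=W$ for some $t\in\mathbb Q$. Then for each $s\in\mathbb Q$ there is $\beta_s\in K$ with $WA_s=W\beta_s=\beta_sW^{\sigma(s)}$,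 and there is $l\in\mathbb N$ such that $H_{1/l}$ is of Type (e) in $K[X^{1/l},X^{-1/l};\sigma(1/l)]$ with $O_l(A_{1/l})=W$; fix these choices. Let $r=n_1/m_1\in\mathbb Q$ in lowest terms with $m_1\in\mathbb N$, and put $q=lm_1$. For $n,i\in\mathbb N$ put $\gamma_{(n,0,q)}=\delta_{(-n,0,q)}=1$, $$\gamma_{(n,i,q)}=\beta_{\frac1{nq}}\beta_{\frac1{nq}}^{\sigma(\frac1{nq})}\cdots\beta_{\frac1{nq}}^{\sigma(\frac{i-1}{nq})},\quad \gamma_{(n,-i,q)}=(\gamma_{(n,i,q)}^{-1})^{\sigma(-\frac{i}{nq})},$$ $$\delta_{(-n,i,q)}=\beta_{-\frac1{nq}}(\beta_{-\frac1{nq}})^{\sigma(-\frac1{nq})}\cdots(\beta_{-\frac1{nq}})^{\sigma(-\frac{i-1}{nq})},\quad \delta_{(-n,-i,q)}=(\delta_{(-n,i,q)}^{-1})^{\sigma(\frac{i}{nq})}.$$ For each $n\in\mathbb N$ there are nice maps $g_{\frac1{nq}},h_{\frac1{nq}}:\frac1{nq}\mathbb Z\to\mathbb Z$ determined by $WA_{\frac{i}{nq}}=Wb^{g_{\frac1{nq}}(\frac{i}{nq})}\gamma_{(n,i,q)}$ and $WA_{-\frac{i}{nq}}=Wb^{h_{\frac1{nq}}(\frac{i}{nq})}\delta_{(-n,i,q)}$ for all $i\in\mathbb Z$. Define $l_r=\sup\{g_{\frac1{nq}}(r)\mid n\in\mathbb N\}$ and $k_r=\sup\{h_{\frac1{nq}}(r)\mid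 n\in\mathbb N\}$; these do not depend on the choice of $l$. *)

theory Defs
  imports
    "HOL-Algebra.Subrings"
    "HOL-Library.Extended_Real"
    "HOL.Hull"
begin

text \<open>The division ring \<open>K\<close> is the universe of a type of class \<open>division_ring\<close>. Its
  subrings, ideals etc. are sets; \<open>r_mult I a\<close> and \<open>l_mult a I\<close> stand for \<open>I a\<close> and \<open>a I\<close>.
  Skew group rings over \<open>K\<close> are rings in the sense of \<open>HOL-Algebra\<close>.\<close>

section \<open>Subsets of the division ring\<close>

definition additive_subgrp :: "'a::division_ring set \<Rightarrow> bool" where
  "additive_subgrp I \<longleftrightarrow> 0 \<in> I \<and> (\<forall>x\<in>I. \<forall>y\<in>I. x - y \<in> I)"

definition is_subring :: "'a::division_ring set \<Rightarrow> bool" where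
  "is_subring R \<longleftrightarrow> additive_subgrp R \<and> 1 \<in> R \<and> (\<forall>x\<in>R. \<forall>y\<in>R. x * y \<in> R)"

definition set_prod :: "'a::division_ring set \<Rightarrow> 'a set \<Rightarrow> 'a set" where
  "set_prod I J = additive_subgrp hull {x * y | x y. x \<in> I \<and> y \<in> J}"

definition r_mult :: "'a::division_ring set \<Rightarrow> 'a \<Rightarrow> 'a set" where
  "r_mult I a = (\<lambda>x. x * a) ` I"

definition l_mult :: "'a::division_ring \<Rightarrow> 'a set \<Rightarrow> 'a set" where
  "l_mult a I = (\<lambda>x. a * x) ` I"

definition left_order :: "'a::division_ring set \<Rightarrow> 'a set" where
  "left_order I = {a. l_mult a I \<subseteq> I}"

definition total_valuation_ring :: "'a::division_ring set \<Rightarrow> bool" where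
  "total_valuation_ring V \<longleftrightarrow> is_subring V \<and> (\<forall>k. k \<noteq> 0 \<longrightarrow> k \<in> V \<or> inverse k \<in> V)"

definition left_ideal :: "'a::division_ring set \<Rightarrow> 'a set \<Rightarrow> bool" where
  "left_ideal R L \<longleftrightarrow> L \<subseteq> R \<and> additive_subgrp L \<and> (\<forall>r\<in>R. \<forall>x\<in>L. r * x \<in> L)"

definition maximal_left_ideal :: "'a::division_ring set \<Rightarrow> 'a set \<Rightarrow> bool" where
  "maximal_left_ideal R L \<longleftrightarrow> left_ideal R L \<and> L \<noteq> R \<and>
     (\<forall>M. left_ideal R M \<longrightarrow> L \<subseteq> M \<longrightarrow> M = L \<or> M = R)"

definition jacobson :: "'a::division_ring set \<Rightarrow> 'a set" where
  "jacobson R = R \<inter> \<Inter>{L. maximal_left_ideal R L}"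


section \<open>Skew group rings\<close>

definition ring_automorphism :: "('a::division_ring \<Rightarrow> 'a) \<Rightarrow> bool" where
  "ring_automorphism \<phi> \<longleftrightarrow> bij \<phi> \<and> \<phi> 1 = 1 \<and>
     (\<forall>x y. \<phi> (x + y) = \<phi> x + \<phi> y) \<and> (\<forall>x y. \<phi> (x * y) = \<phi> x * \<phi> y)"

definition rat_action :: "(rat \<Rightarrow> 'a::division_ring \<Rightarrow> 'a) \<Rightarrow> bool" where
  "rat_action \<sigma> \<longleftrightarrow> (\<forall>g. ring_automorphism (\<sigma> g)) \<and> (\<forall>g h. \<sigma> (g + h) = \<sigma> g \<circ> \<sigma> h)"

text \<open>\<open>homog a g\<close> is the homogeneous element \<open>a X\<^sup>g\<close>; a function \<open>x\<close> of finite support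
  is the formal sum of the \<open>(x g) X\<^sup>g\<close>.\<close>

definition homog :: "'a::division_ring \<Rightarrow> rat \<Rightarrow> rat \<Rightarrow> 'a" where
  "homog a g = (\<lambda>h. if h = g then a else 0)"

definition skew_group_ring ::
    "rat set \<Rightarrow> (rat \<Rightarrow> 'a::division_ring \<Rightarrow> 'a) \<Rightarrow> (rat \<Rightarrow> 'a) ring" where
  "skew_group_ring G \<sigma> =
     \<lparr> carrier = {x. finite {g. x g \<noteq> 0} \<and> {g. x g \<noteq> 0} \<subseteq> G},
       monoid.mult = (\<lambda>x y t. \<Sum>s | x s \<noteq> 0. x s * \<sigma> s (y (t - s))),
       one = homog 1 0,
       zero = (\<lambda>_. 0),
       add = (\<lambda>x y t. x t + y t) \<rparr>"

definition multiples :: "rat \<Rightarrow> rat set" where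
  "multiples g = range (\<lambda>i::int. of_int i * g)"

text \<open>A family \<open>A\<close> of subsets of \<open>K\<close> is indexed by all rationals, but only its members with
  index in \<open>G\<close> matter for the direct sum over \<open>G\<close>. So the restriction of the direct sum over
  the rationals to the multiples of \<open>r\<close> is given by the same family with \<open>G = multiples r\<close>.\<close>

definition graded_sum ::
    "rat set \<Rightarrow> (rat \<Rightarrow> 'a::division_ring \<Rightarrow> 'a) \<Rightarrow> (rat \<Rightarrow> 'a set) \<Rightarrow> (rat \<Rightarrow> 'a) set" where
  "graded_sum G \<sigma> A = {x \<in> carrier (skew_group_ring G \<sigma>). \<forall>g\<in>G. x g \<in> A g}"

definition graded_total_valuation_ring ::
    "rat set \<Rightarrow> (rat \<Rightarrow> 'a::division_ring \<Rightarrow> 'a) \<Rightarrow> (rat \<Rightarrow> 'a set) \<Rightarrow> bool" where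
  "graded_total_valuation_ring G \<sigma> A \<longleftrightarrow>
     subring (graded_sum G \<sigma> A) (skew_group_ring G \<sigma>) \<and>
     (\<forall>g\<in>G. \<forall>a. a \<noteq> 0 \<longrightarrow>
        homog a g \<in> graded_sum G \<sigma> A \<or>
        inv\<^bsub>skew_group_ring G \<sigma>\<^esub> (homog a g) \<in> graded_sum G \<sigma> A)"

definition graded_extension ::
    "rat set \<Rightarrow> (rat \<Rightarrow> 'a::division_ring \<Rightarrow> 'a) \<Rightarrow> 'a set \<Rightarrow> (rat \<Rightarrow> 'a set) \<Rightarrow> bool" where
  "graded_extension G \<sigma> V A \<longleftrightarrow> graded_total_valuation_ring G \<sigma> A \<and> A 0 = V"


section \<open>Types of graded extensions\<close>

definition type_II ::
    "rat set \<Rightarrow> (rat \<Rightarrow> 'a::division_ring \<Rightarrow> 'a) \<Rightarrow> 'a set \<Rightarrow> (rat \<Rightarrow> 'a set) \<Rightarrow> bool" where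
  "type_II G \<sigma> V A \<longleftrightarrow> graded_extension G \<sigma> V A \<and>
     (\<exists>g\<in>G. \<exists>h\<in>G. 0 < g \<and> 0 < h \<and>
        (set_prod (A g) (\<sigma> g ` A h) \<noteq> A (g + h) \<or>
         set_prod (A (- g)) (\<sigma> (- g) ` A (- h)) \<noteq> A (- g - h)))"

definition union_ring :: "(rat \<Rightarrow> 'a::division_ring set) \<Rightarrow> 'a set" where
  "union_ring A = (\<Union>s. left_order (A s))"

text \<open>Type (e) over the rationals and over the multiples of \<open>g\<close>. Elements whose inverses
  occur are required to be nonzero, since \<open>inverse 0 = 0\<close>.\<close>

definition type_e ::
    "(rat \<Rightarrow> 'a::division_ring \<Rightarrow> 'a) \<Rightarrow> 'a set \<Rightarrow> (rat \<Rightarrow> 'a set) \<Rightarrow> bool" where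
  "type_e \<sigma> V A \<longleftrightarrow> graded_extension UNIV \<sigma> V A \<and>
     (\<exists>r>0. type_II (multiples r) \<sigma> V A) \<and>
     is_subring (union_ring A) \<and>
     (\<exists>b. b \<noteq> 0 \<and> jacobson (union_ring A) = l_mult (inverse b) (union_ring A))"

definition type_e_cyclic ::
    "rat \<Rightarrow> (rat \<Rightarrow> 'a::division_ring \<Rightarrow> 'a) \<Rightarrow> 'a set \<Rightarrow> (rat \<Rightarrow> 'a set) \<Rightarrow> bool" where
  "type_e_cyclic g \<sigma> V A \<longleftrightarrow> graded_extension (multiples g) \<sigma> V A \<and>
     (let U = left_order (A g) in
        (\<exists>a. a \<noteq> 0 \<and> A g = r_mult U a \<and> A g = l_mult a (\<sigma> g ` U) \<and>
             A (- g) = r_mult (jacobson U) (\<sigma> (- g) (inverse a))) \<and>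
        (\<exists>c. c \<noteq> 0 \<and> jacobson U = r_mult U (inverse c)))"

definition graded_map :: "rat set \<Rightarrow> (rat \<Rightarrow> int) \<Rightarrow> bool" where
  "graded_map G f \<longleftrightarrow> f 0 = 0 \<and>
     (\<forall>s\<in>G. \<forall>t\<in>G. f s + f t \<le> f (s + t) \<and> - 1 \<le> f s + f (- s))"


section \<open>The suprema $l_r$ and $k_r$\<close>

text \<open>The choices \<open>\<beta>\<^sub>s\<close> and \<open>l\<close> are fixed by Hilbert's operator. They exist, and the suprema
  below do not depend on them, if \<open>A\<close> is of Type (e), \<open>W = union_ring A\<close> is some
  \<open>left_order (A t)\<close> and \<open>J(W) = b\<^sup>-\<^sup>1 W\<close>; this is the only case where the suprema are used.\<close>

definition chosen_beta ::
    "(rat \<Rightarrow> 'a::division_ring \<Rightarrow> 'a) \<Rightarrow> (rat \<Rightarrow> 'a set) \<Rightarrow> rat \<Rightarrow> 'a" where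
  "chosen_beta \<sigma> A s = (let W = union_ring A in
     SOME c. set_prod W (A s) = r_mult W c \<and> r_mult W c = l_mult c (\<sigma> s ` W))"

definition chosen_l ::
    "(rat \<Rightarrow> 'a::division_ring \<Rightarrow> 'a) \<Rightarrow> (rat \<Rightarrow> 'a set) \<Rightarrow> nat" where
  "chosen_l \<sigma> A = (SOME l. 0 < l \<and> type_e_cyclic (1 / of_nat l) \<sigma> (A 0) A \<and>
     left_order (A (1 / of_nat l)) = union_ring A)"

text \<open>\<open>skew_power \<sigma> u a i\<close> is the coefficient of \<open>X\<close> to the \<open>i u\<close> in the \<open>i\<close>-th power of
  \<open>a X\<^sup>u\<close>.\<close>

primrec skew_power_nat ::
    "(rat \<Rightarrow> 'a::division_ring \<Rightarrow> 'a) \<Rightarrow> rat \<Rightarrow> 'a \<Rightarrow> nat \<Rightarrow> 'a" where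
  "skew_power_nat \<sigma> u a 0 = 1"
| "skew_power_nat \<sigma> u a (Suc i) = skew_power_nat \<sigma> u a i * \<sigma> (of_nat i * u) a"

definition skew_power ::
    "(rat \<Rightarrow> 'a::division_ring \<Rightarrow> 'a) \<Rightarrow> rat \<Rightarrow> 'a \<Rightarrow> int \<Rightarrow> 'a" where
  "skew_power \<sigma> u a i =
     (if 0 \<le> i then skew_power_nat \<sigma> u a (nat i)
      else \<sigma> (of_int i * u) (inverse (skew_power_nat \<sigma> u a (nat (- i)))))"

text \<open>\<open>gamma_coeff \<sigma> \<beta> n i q\<close> is $\gamma_{(n,i,q)}$ and \<open>delta_coeff \<sigma> \<beta> n i q\<close> is
  $\delta_{(-n,i,q)}$, for \<open>i\<close> of any sign.\<close>

definition gamma_coeff ::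
    "(rat \<Rightarrow> 'a::division_ring \<Rightarrow> 'a) \<Rightarrow> (rat \<Rightarrow> 'a) \<Rightarrow> nat \<Rightarrow> int \<Rightarrow> nat \<Rightarrow> 'a" where
  "gamma_coeff \<sigma> \<beta> n i q =
     (let u = 1 / (of_nat n * of_nat q) in skew_power \<sigma> u (\<beta> u) i)"

definition delta_coeff ::
    "(rat \<Rightarrow> 'a::division_ring \<Rightarrow> 'a) \<Rightarrow> (rat \<Rightarrow> 'a) \<Rightarrow> nat \<Rightarrow> int \<Rightarrow> nat \<Rightarrow> 'a" where
  "delta_coeff \<sigma> \<beta> n i q =
     (let u = - (1 / (of_nat n * of_nat q)) in skew_power \<sigma> u (\<beta> u) i)"

text \<open>The maps $g_{1/nq}$ and $h_{1/nq}$, to be evaluated at \<open>x = i / (n q)\<close> with \<open>i\<close> an integer.\<close>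

definition g_map :: "(rat \<Rightarrow> 'a::division_ring \<Rightarrow> 'a) \<Rightarrow> 'a \<Rightarrow> (rat \<Rightarrow> 'a set) \<Rightarrow>
    nat \<Rightarrow> nat \<Rightarrow> rat \<Rightarrow> int" where
  "g_map \<sigma> b A n q x =
     (let W = union_ring A; i = \<lfloor>x * of_nat n * of_nat q\<rfloor> in
      THE e. set_prod W (A x) =
             r_mult W (b powi e * gamma_coeff \<sigma> (chosen_beta \<sigma> A) n i q))"

definition h_map :: "(rat \<Rightarrow> 'a::division_ring \<Rightarrow> 'a) \<Rightarrow> 'a \<Rightarrow> (rat \<Rightarrow> 'a set) \<Rightarrow>
    nat \<Rightarrow> nat \<Rightarrow> rat \<Rightarrow> int" where
  "h_map \<sigma> b A n q x =
     (let W = union_ring A; i = \<lfloor>x * of_nat n * of_nat q\<rfloor> in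
      THE e. set_prod W (A (- x)) =
             r_mult W (b powi e * delta_coeff \<sigma> (chosen_beta \<sigma> A) n i q))"

definition q_of :: "(rat \<Rightarrow> 'a::division_ring \<Rightarrow> 'a) \<Rightarrow> (rat \<Rightarrow> 'a set) \<Rightarrow> rat \<Rightarrow> nat" where
  "q_of \<sigma> A r = chosen_l \<sigma> A * nat (snd (quotient_of r))"

definition l_sup :: "(rat \<Rightarrow> 'a::division_ring \<Rightarrow> 'a) \<Rightarrow> 'a \<Rightarrow> (rat \<Rightarrow> 'a set) \<Rightarrow>
    rat \<Rightarrow> ereal" where
  "l_sup \<sigma> b A r = (SUP n\<in>{1..}. ereal (of_int (g_map \<sigma> b A n (q_of \<sigma> A r) r)))"

definition k_sup :: "(rat \<Rightarrow> 'a::division_ring \<Rightarrow> 'a) \<Rightarrow> 'a \<Rightarrow> (rat \<Rightarrow> 'a set) \<Rightarrow>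
    rat \<Rightarrow> ereal" where
  "k_sup \<sigma> b A r = (SUP n\<in>{1..}. ereal (of_int (h_map \<sigma> b A n (q_of \<sigma> A r) r)))"

end

theory Submission
  imports Defs
begin

text \<open>
Write \<open>W A\<^sub>s\<close> for the left \<open>W\<close>-module spanned by the component \<open>A\<^sub>s\<close>. The radical of \<open>W\<close> is
\<open>W b\<^sup>-\<^sup>1 = b\<^sup>-\<^sup>1 W\<close>, so it is discrete: no left \<open>W\<close>-module lies strictly between \<open>W\<close> and its
radical.

Let \<open>A\<close> be a graded extension. Discreteness makes every component with left order \<open>W\<close> principal, and
since no component has a left order beyond \<open>W\<close>, a generator of it normalizes \<open>W\<close> (\<open>top_normalizing\<close>).
Multiplying with such a component transfers this to all degrees (\<open>generator\<close>):
\<open>W A\<^sub>s = W \<beta>\<^sub>s = \<beta>\<^sub>s W\<^bsup>\<sigma>(s)\<^esup>\<close>. Hence the classes of the \<open>\<beta>\<^sub>s\<close> modulo units of \<open>W\<close> lie in a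
group in which \<open>b\<close> is central, and \<open>\<beta>\<^sub>s \<beta>\<^sub>t\<^bsup>\<sigma>(s)\<^esup>\<close> is \<open>\<beta>\<^bsub>s + t\<^esub>\<close> up to a factor
\<open>b\<^sup>-\<^sup>\<epsilon>\<close> with a cocycle \<open>\<epsilon>\<close> that takes the values 0 and 1 only (\<open>eps\<close>, \<open>eps_bounds\<close>). A map \<open>f\<close> and
elements \<open>\<alpha>\<^sub>r\<close> as in the theorem are the same as a splitting \<open>\<alpha>\<^sub>r = b\<^bsup>- f r\<^esup> \<beta>\<^sub>r\<close> of the resulting
central extension of the rationals by the powers of \<open>b\<close>. Such extensions do not split in general.
The suprema in the hypothesis are bounds for the exponents by which the powers of
\<open>\<beta>\<^bsub>1/N\<^esub>\<close>, or of \<open>\<beta>\<^bsub>-1/N\<^esub>\<close>, miss the fixed class of \<open>\<beta>\<^sub>m\<close>, or of \<open>\<beta>\<^bsub>-m\<^esub>\<close>. These exponents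
grow along divisibility of \<open>N\<close>, so a bound makes them stationary, and then the \<open>\<beta>\<^bsub>1/N\<^esub>\<close> are
compatible roots of each other and define the splitting (\<open>bounded_imp_coboundary\<close>).

The degrees \<open>s\<close> with \<open>f s + f (- s) = 0\<close> form a proper subgroup, on which a nonzero \<open>f\<close> is injective
and additive; so they are cyclic (\<open>least_period\<close>, \<open>invertible_degrees_eq_multiples\<close>). For \<open>W \<noteq> V\<close> they are exactly
the degrees in which \<open>A\<^sub>s\<close> is smaller than \<open>W A\<^sub>s\<close>, and there \<open>A\<^sub>s\<close> still contains \<open>b\<^sup>-\<^sup>1 \<beta>\<^sub>s\<close>. This
gives the description of the components.

Conversely, components of this form multiply correctly outside the exceptional degrees because \<open>f\<close> is
superadditive, and for \<open>W \<noteq> V\<close> products that fall into an exceptional degree from outside lose a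
factor \<open>b\<close>, hence land inside the component (\<open>family_from_subgroup\<close>, \<open>graded_family\<close>). The
extension is of Type (II) over some cyclic group because a nonzero integer-valued map on the rationals cannot be additive on positive and on
negative degrees (\<open>not_additive\<close>).
\<close>

section \<open>Integer cocycles on the rationals\<close>

text \<open>In the central extension of the rationals by the integers that a cocycle defines, this is the
exponent by which the \<open>n\<close>-th power of the chosen lift of \<open>u\<close> differs from the chosen lift
of \<open>n u\<close>.\<close>

definition partial_cocycle_sum :: "(rat \<Rightarrow> rat \<Rightarrow> int) \<Rightarrow> rat \<Rightarrow> nat \<Rightarrow> int" where
  "partial_cocycle_sum \<epsilon> u n = (\<Sum>j<n. \<epsilon> (of_nat j * u) u)"

locale rational_cocycle =
  fixes \<epsilon> :: "rat \<Rightarrow> rat \<Rightarrow> int"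
  assumes cocycle: "\<epsilon> r s + \<epsilon> (r + s) t = \<epsilon> s t + \<epsilon> r (s + t)"
    and nonneg: "0 \<le> \<epsilon> r s"
    and zero_left [simp]: "\<epsilon> 0 s = 0"
    and zero_right [simp]: "\<epsilon> s 0 = 0"
begin

abbreviation E where "E \<equiv> partial_cocycle_sum \<epsilon>"

lemma sum_nonneg': "0 \<le> E u n"
  unfolding partial_cocycle_sum_def by (intro sum_nonneg nonneg)

lemma sum_0 [simp]: "E u 0 = 0"
  and sum_Suc: "E u (Suc n) = E u n + \<epsilon> (of_nat n * u) u"
  by (simp_all add: partial_cocycle_sum_def)

lemma sum_add: "E u (m + n) = E u m + E u n + \<epsilon> (of_nat m * u) (of_nat n * u)"
proof (induction n)
  case (Suc n)
  have "\<epsilon> (of_nat m * u) (of_nat n * u) + \<epsilon> (of_nat m * u + of_nat n * u) u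
      = \<epsilon> (of_nat n * u) u + \<epsilon> (of_nat m * u) (of_nat n * u + u)"
    by (rule cocycle)
  with Suc show ?case
    by (simp add: sum_Suc algebra_simps)
qed simp

lemma sum_mult: "E u (m * n) = int n * E u m + E (of_nat m * u) n"
proof (induction n)
  case (Suc n)
  have "E u (m * Suc n) = E u (m * n + m)" by (simp add: algebra_simps)
  also have "\<dots> = E u (m * n) + E u m + \<epsilon> (of_nat (m * n) * u) (of_nat m * u)"
    by (rule sum_add)
  finally show ?case using Suc by (simp add: sum_Suc algebra_simps)
qed simp

text \<open>The degrees \<open>s\<close> with \<open>\<epsilon> s (- s) = 0\<close> are those whose chosen lift is inverse to the chosen lift
of \<open>- s\<close>. They form a subgroup, since by nonnegativity \<open>\<epsilon>\<close> vanishes at all pairs that start with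
such a degree. So if they contain all \<open>1 / l\<close>, they are all of the rationals.\<close>

lemma swap_neg: "\<epsilon> (- s) s = \<epsilon> s (- s)"
  using cocycle[of s "-s" s] by simp

lemma vanish_left: "\<epsilon> s (- s) = 0 \<Longrightarrow> \<epsilon> s t = 0"
  using cocycle[of "-s" s t] nonneg[of s t] nonneg[of "-s" "s + t"] by (simp add: swap_neg)

lemma vanish_add:
  assumes "\<epsilon> s (- s) = 0" "\<epsilon> t (- t) = 0"
  shows "\<epsilon> (s + t) (- (s + t)) = 0"
  using cocycle[of s t "- (s + t)"] vanish_left[OF assms(1)] vanish_left[OF assms(2)] by simp

lemma vanish_all:
  assumes "\<And>l. 0 < l \<Longrightarrow> \<epsilon> (1 / of_nat l) (- (1 / of_nat l)) = 0"
  shows "\<epsilon> s (- s) = 0"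
proof -
  have pos: "\<epsilon> (of_nat n / of_nat l) (- (of_nat n / of_nat l)) = 0" if "0 < l" for n l :: nat
  proof (induction n)
    case (Suc n)
    show ?case using vanish_add[OF Suc assms[OF that]] by (simp add: add_divide_distrib add.commute)
  qed simp
  obtain p d where pd: "s = of_int p / of_int d" "d > 0"
    using quotient_of_div[of s] quotient_of_denom_pos[of s] by (metis surj_pair)
  then have *: "\<epsilon> (\<bar>s\<bar>) (- \<bar>s\<bar>) = 0"
    using pos[of "nat d" "nat \<bar>p\<bar>"] by (simp add: abs_divide)
  then show ?thesis using swap_neg[of s] by (cases "s \<ge> 0") simp_all
qed

text \<open>A central extension of the rationals by the integers need not split, but it does under a bound.
Along divisibility of \<open>n\<close> the integers \<open>E (1 / (n q)) (M n)\<close> can only grow, because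
\<open>\<epsilon> \<ge> 0\<close>; if they are bounded, they become stationary at some \<open>n0\<close>. From there on the chosen
lifts of the \<open>1 / N\<close> are powers of one another, so their powers are a homomorphic lift of the
nonnegative rationals. A cocycle that is a coboundary on the nonnegative rationals is one
everywhere.\<close>

lemma bounded_imp_coboundary:
  fixes C :: int and q M :: nat
  assumes "0 < q" "0 < M" and bound: "\<And>n. 1 \<le> n \<Longrightarrow> E (1 / of_nat (n * q)) (M * n) \<le> C"
  obtains f :: "rat \<Rightarrow> int" where "\<And>r s. f (r + s) = f r + f s + \<epsilon> r s"
proof -
  define e where "e n = E (1 / of_nat (n * q)) (M * n)" for n
  have e_mult: "e (n * d) = int (M * n) * E (1 / of_nat (n * d * q)) d + e n" if "0 < n" "0 < d" for n d
  proof -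
    have eq: "of_nat d * (1 / of_nat (n * d * q)) = (1 / of_nat (n * q) :: rat)"
      using that \<open>0 < q\<close> by simp
    show ?thesis using sum_mult[of "1 / of_nat (n * d * q)" d "M * n"] unfolding eq e_def
      by (simp add: ac_simps)
  qed
  obtain n0 where n0: "0 < n0" "\<And>n. 0 < n \<Longrightarrow> e n \<le> e n0"
  proof -
    have nn: "0 \<le> e n" for n by (simp add: e_def sum_nonneg')
    have fin: "finite (e ` {1..})"
      by (rule finite_subset[of _ "{0..C}"]) (use nn bound in \<open>auto simp: e_def\<close>)
    have "Max (e ` {1..}) \<in> e ` {1..}" by (rule Max_in[OF fin]) auto
    then obtain n0 where "n0 \<ge> 1" "e n0 = Max (e ` {1..})" by auto
    then show ?thesis using fin that[of n0] by auto
  qed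
  have const: "e (n0 * d) = e n0" if "0 < d" for d
    using e_mult[OF n0(1) that] sum_nonneg'[of "1 / of_nat (n0 * d * q)" d] n0 that n0(2)[of "n0 * d"]
    by (intro antisym) auto
  define N where "N = n0 * q"
  have "0 < N" using n0 assms by (simp add: N_def)
  \<comment> \<open>beyond \<open>n0\<close> the lift of \<open>1 / (N d)\<close> is exactly the \<open>c\<close>-th power of that of \<open>1 / (N d c)\<close>\<close>
  have refine: "E (1 / of_nat (N * d * c)) c = 0" if "0 < d" "0 < c" for d c
  proof -
    have "int (M * (n0 * d)) * E (1 / of_nat (n0 * d * c * q)) c = 0"
      using e_mult[of "n0 * d" c] const[of d] const[of "d * c"] that n0(1) by (simp add: ac_simps)
    then show ?thesis using assms that n0(1) by (simp add: N_def ac_simps)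
  qed
  have expand: "E (1 / of_nat (N * d * c)) (i * c) = E (1 / of_nat (N * d)) i"
    if "0 < d" "0 < c" for d c i
  proof -
    have eq: "of_nat c * (1 / of_nat (N * d * c)) = (1 / of_nat (N * d) :: rat)"
      using that by simp
    show ?thesis using sum_mult[of "1 / of_nat (N * d * c)" c i] refine[OF that] unfolding eq
      by (simp add: ac_simps)
  qed
  \<comment> \<open>the value at \<open>i / (N d)\<close> is \<open>E (1 / (N d)) i\<close>; it is read off from the reduced fraction
    in order not to depend on the representation\<close>
  define F where "F x = (let (p, d) = quotient_of x in
      E (1 / of_nat (N * nat d)) (nat p * N))" for x
  have F: "F (of_nat i / of_nat (N * d)) = E (1 / of_nat (N * d)) i" if d: "0 < d" for i d
  proof -
    define x :: rat where "x = of_nat i / of_nat (N * d)"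
    obtain p d' where pd: "quotient_of x = (p, d')" by fastforce
    have d': "d' > 0" using quotient_of_denom_pos[OF pd] .
    have x: "x = of_int p / of_int d'" using quotient_of_div[OF pd] .
    have "0 \<le> x" by (simp add: x_def)
    then have p: "p \<ge> 0" using d' by (simp add: x zero_le_divide_iff)
    define P D where "P = nat p" and "D = nat d'"
    have PD: "p = int P" "d' = int D" "0 < D" using p d' by (auto simp: P_def D_def)
    have "of_nat i / of_nat (N * d) = (of_nat P / of_nat D :: rat)"
      using x PD by (simp add: x_def)
    then have "(of_nat (i * D) :: rat) = of_nat (P * (N * d))"
      using PD(3) d \<open>0 < N\<close> by (simp add: field_simps)
    then have cross: "i * D = P * N * d" by (simp only: of_nat_eq_iff mult.assoc)
    have "F x = E (1 / of_nat (N * D)) (P * N)" by (simp add: F_def pd P_def D_def)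
    also have "\<dots> = E (1 / of_nat (N * D * d)) (P * N * d)" using expand[of D d "P * N"] PD d by simp
    also have "\<dots> = E (1 / of_nat (N * d * D)) (i * D)"
      unfolding cross by (simp only: ac_simps)
    also have "\<dots> = E (1 / of_nat (N * d)) i" using expand[of d D i] PD d by simp
    finally show ?thesis by (simp add: x_def)
  qed
  have F_add: "F (x + y) = F x + F y + \<epsilon> x y" if xy: "0 \<le> x" "0 \<le> y" for x y
  proof -
    obtain p d where pd: "x = of_int p / of_int d" "d > 0"
      using quotient_of_div[of x] quotient_of_denom_pos[of x] by (metis surj_pair)
    obtain p' d' where pd': "y = of_int p' / of_int d'" "d' > 0"
      using quotient_of_div[of y] quotient_of_denom_pos[of y] by (metis surj_pair)
    have p: "p \<ge> 0" "p' \<ge> 0" using xy pd pd' by (auto simp: zero_le_divide_iff)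
    define D where "D = nat (d * d')"
    define i j where "i = nat (p * d') * N" and "j = nat (p' * d) * N"
    have D: "D > 0" using pd pd' by (simp add: D_def)
    have x: "x = of_nat i / of_nat (N * D)" and y: "y = of_nat j / of_nat (N * D)"
      using pd pd' p \<open>0 < N\<close> by (auto simp: i_def j_def D_def field_simps)
    have xy: "x + y = of_nat (i + j) / of_nat (N * D)" unfolding x y by (simp add: add_divide_distrib)
    show ?thesis
      unfolding xy F[OF D] sum_add unfolding x y F[OF D] by simp
  qed
  have F0: "F 0 = 0" using F_add[of 0 0] by simp
  \<comment> \<open>the choice at \<open>- x\<close> makes the corrected cocycle \<open>\<delta>\<close> vanish at \<open>(x, - x)\<close>; the cocycle
    identity then kills \<open>\<delta>\<close> on each pair of signs in turn\<close>
  define f where "f x = (if 0 \<le> x then F x else - F (- x) - \<epsilon> (- x) x)" for x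
  define \<delta> where "\<delta> r s = \<epsilon> r s + f r + f s - f (r + s)" for r s
  have \<delta>_cocycle: "\<delta> r s + \<delta> (r + s) t = \<delta> s t + \<delta> r (s + t)" for r s t
    using cocycle[of r s t] by (simp add: \<delta>_def add.assoc)
  have \<delta>0 [simp]: "\<delta> 0 s = 0" "\<delta> s 0 = 0" for s
    by (simp_all add: \<delta>_def f_def F0)
  have pp: "\<delta> x y = 0" if "0 \<le> x" "0 \<le> y" for x y
    using that F_add[OF that] by (simp add: \<delta>_def f_def)
  have inv1: "\<delta> x (- x) = 0" if "0 \<le> x" for x
    using that by (cases "x = 0") (auto simp: \<delta>_def f_def F0)
  have inv2: "\<delta> (- x) x = 0" if "0 \<le> x" for x
    using \<delta>_cocycle[of x "-x" x] inv1[OF that] by simp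
  have a: "\<delta> x (- y) = 0" if "0 \<le> y" "y \<le> x" for x y
    using \<delta>_cocycle[of "x - y" y "- y"] pp[of "x - y" y] inv1[of y] that by simp
  have nn: "\<delta> (- x) (- y) = 0" if "0 \<le> x" "0 \<le> y" for x y
    using \<delta>_cocycle[of "x + y" "- x" "- y"] a[of x "x + y"] inv1[of y] inv1[of "x + y"] that by simp
  have b: "\<delta> x (- y) = 0" if "0 \<le> x" "x \<le> y" for x y
    using \<delta>_cocycle[of x "- x" "x - y"] nn[of x "y - x"] inv1[of x] that by simp
  have c: "\<delta> (- y) x = 0" if "0 \<le> x" "x \<le> y" for x y
    using \<delta>_cocycle[of "x - y" "- x" x] nn[of "y - x" x] inv2[of x] that by simp
  have d: "\<delta> (- y) x = 0" if "0 \<le> y" "y \<le> x" for x y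
    using \<delta>_cocycle[of "- y" y "x - y"] pp[of y "x - y"] inv2[of y] that by simp
  have all: "\<delta> r s = 0" for r s
  proof (cases "0 \<le> r"; cases "0 \<le> s")
    assume "0 \<le> r" "\<not> 0 \<le> s"
    then show ?thesis using a[of "- s" r] b[of r "- s"] by (cases "- s \<le> r") auto
  next
    assume "\<not> 0 \<le> r" "0 \<le> s"
    then show ?thesis using c[of s "- r"] d[of "- r" s] by (cases "s \<le> - r") auto
  next
    assume "\<not> 0 \<le> r" "\<not> 0 \<le> s"
    then show ?thesis using nn[of "- r" "- s"] by simp
  qed (rule pp)
  have "f (r + s) = f r + f s + \<epsilon> r s" for r s using all[of r s] by (simp add: \<delta>_def)
  then show ?thesis by (rule that)
qed

end

section \<open>Graded maps\<close>

locale graded_mapping =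
  fixes f :: "rat \<Rightarrow> int"
  assumes graded: "graded_map UNIV f"
begin

lemma f0: "f 0 = 0" and superadd: "f s + f t \<le> f (s + t)" and sym_lower: "- 1 \<le> f s + f (- s)"
  using graded by (auto simp: graded_map_def)

lemma sym_upper: "f s + f (- s) \<le> 0"
  using superadd[of s "- s"] f0 by simp

lemma sym_cases: "f s + f (- s) = 0 \<or> f s + f (- s) = - 1"
  using sym_upper[of s] sym_lower[of s] by linarith

text \<open>On these degrees \<open>f\<close> is additive, and even \<open>f (s + t) = f s + f t\<close> for every \<open>t\<close>.\<close>

definition invertible_degrees where "invertible_degrees = {s. f s + f (- s) = 0}"

lemma additive_on_invertible: "s \<in> invertible_degrees \<Longrightarrow> f (s + t) = f s + f t"
  using superadd[of s t] superadd[of "- s" "s + t"] by (auto simp: invertible_degrees_def)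

lemma invertible_0: "0 \<in> invertible_degrees" by (simp add: invertible_degrees_def f0)
lemma invertible_neg: "s \<in> invertible_degrees \<Longrightarrow> - s \<in> invertible_degrees" by (simp add: invertible_degrees_def add.commute)
lemma invertible_add:
  assumes "s \<in> invertible_degrees" "t \<in> invertible_degrees" shows "s + t \<in> invertible_degrees"
  using additive_on_invertible[OF assms(1), of t] additive_on_invertible[OF invertible_neg[OF assms(1)], of "- t"] assms
  by (simp add: invertible_degrees_def)
lemma invertible_diff: "s \<in> invertible_degrees \<Longrightarrow> t \<in> invertible_degrees \<Longrightarrow> s - t \<in> invertible_degrees"
  using invertible_add[of s "- t"] invertible_neg by simp

lemma invertible_of_nat_mult: "s \<in> invertible_degrees \<Longrightarrow> of_nat n * s \<in> invertible_degrees \<and> f (of_nat n * s) = int n * f s"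
proof (induction n)
  case (Suc n)
  then show ?case using invertible_add[of s "of_nat n * s"] additive_on_invertible[of s "of_nat n * s"]
    by (simp add: algebra_simps)
qed (simp_all add: invertible_0 f0)

lemma invertible_of_int_mult:
  assumes "s \<in> invertible_degrees" shows "of_int n * s \<in> invertible_degrees \<and> f (of_int n * s) = n * f s"
proof (cases "0 \<le> n")
  case True
  then show ?thesis using invertible_of_nat_mult[OF assms, of "nat n"] by simp
next
  case False
  have "f (- s) = - f s" using assms by (simp add: invertible_degrees_def)
  then show ?thesis using invertible_of_nat_mult[OF invertible_neg[OF assms], of "nat (- n)"] False by simp
qed

lemma superadd_mult: "int n * f s \<le> f (of_nat n * s)"
proof (induction n)
  case (Suc n)
  then show ?case using superadd[of s "of_nat n * s"] by (simp add: algebra_simps)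
qed (simp add: f0)

text \<open>If \<open>f\<close> vanishes at a nonzero invertible degree \<open>s\<close>, it is periodic modulo \<open>s\<close>. Every \<open>t\<close> has
a multiple in the integral multiples of \<open>s\<close>, so superadditivity gives \<open>f t \<le> 0\<close>; and since \<open>- t\<close> is
a nonnegative multiple of \<open>t\<close> modulo \<open>s\<close>, a zero at \<open>t\<close> forces one at \<open>- t\<close>. As \<open>f t\<close> and \<open>f (- t)\<close>
cannot both be negative, \<open>f\<close> vanishes identically.\<close>

lemma invertible_zero_imp_zero:
  assumes s: "s \<in> invertible_degrees" "s \<noteq> 0" "f s = 0" shows "f t = 0"
proof -
  have flip: "0 \<le> f (- t)" if "0 \<le> f t" and "f t \<le> 0" for t
  proof -
    obtain p d where pd: "t / s = of_int p / of_int d" "d > 0"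
      using quotient_of_div[of "t / s"] quotient_of_denom_pos[of "t / s"] by (metis surj_pair)
    then have "of_int d * t = of_int p * s" using s(2) by (simp add: field_simps)
    then have "of_nat (nat d) * t = of_int p * s" using pd(2) by simp
    then have eq: "- (of_int p * s) + of_nat (nat d - 1) * t = - t"
      using pd(2) by (simp add: of_nat_diff algebra_simps)
    have "- (of_int p * s) \<in> invertible_degrees" "f (- (of_int p * s)) = 0"
      using invertible_of_int_mult[OF s(1), of "- p"] s(3) by simp_all
    then have "f (- t) = f (of_nat (nat d - 1) * t)"
      using additive_on_invertible[of "- (of_int p * s)" "of_nat (nat d - 1) * t"] eq by simp
    also have "\<dots> \<ge> int (nat d - 1) * f t" by (rule superadd_mult)
    also have "int (nat d - 1) * f t = 0" using that by simp
    finally show ?thesis by simp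
  qed
  have upper: "f t \<le> 0" for t
  proof -
    obtain p d where pd: "t / s = of_int p / of_int d" "d > 0"
      using quotient_of_div[of "t / s"] quotient_of_denom_pos[of "t / s"] by (metis surj_pair)
    then have "of_int d * t = of_int p * s" using s(2) by (simp add: field_simps)
    then have "of_nat (nat d) * t = of_int p * s" using pd(2) by simp
    then have "int (nat d) * f t \<le> f (of_int p * s)" using superadd_mult[of "nat d" t] by simp
    also have "\<dots> = 0" using invertible_of_int_mult[OF s(1), of p] s(3) by simp
    finally show ?thesis using pd(2) by (simp add: mult_le_0_iff)
  qed
  show ?thesis using sym_lower[of t] upper[of t] upper[of "- t"] flip[of t] flip[of "- t"]
    by (cases "f t = 0") auto
qed

text \<open>By the preceding lemma a nonzero \<open>f\<close> embeds the group of invertible degrees into the integers,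
so this group is cyclic.\<close>

lemma least_period:
  assumes "f r \<noteq> 0" "k0 \<in> invertible_degrees" "0 < k0"
  obtains k where "k > 0" "k \<in> invertible_degrees" "\<And>k'. k' > 0 \<Longrightarrow> k' \<in> invertible_degrees \<Longrightarrow> k \<le> k'"
proof -
  define p where "p = f k0"
  have p: "p \<noteq> 0" using invertible_zero_imp_zero[of k0 r] assms by (auto simp: p_def)
  have ratio: "s = of_int (f s) * k0 / of_int p" if "s \<in> invertible_degrees" for s
  proof -
    have "of_int p * s - of_int (f s) * k0 \<in> invertible_degrees"
      using invertible_diff invertible_of_int_mult that assms by blast
    moreover have "f (of_int p * s - of_int (f s) * k0) = 0"
    proof -
      have "f (of_int p * s + of_int (- f s) * k0) = f (of_int p * s) + f (of_int (- f s) * k0)"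
        using additive_on_invertible invertible_of_int_mult that by blast
      also have "\<dots> = p * f s + (- f s) * p"
        using invertible_of_int_mult[OF that, of p] invertible_of_int_mult[OF assms(2), of "- f s"] by (simp only: p_def)
      finally show ?thesis by simp
    qed
    ultimately have "of_int p * s - of_int (f s) * k0 = 0"
      using invertible_zero_imp_zero assms(1) by blast
    then show ?thesis using p by (simp add: field_simps)
  qed
  define c where "c = k0 / of_int \<bar>p\<bar>"
  have c: "c > 0" using assms p by (simp add: c_def)
  have nat_mult: "\<exists>n>0. s = of_nat n * c" if "s \<in> invertible_degrees" "0 < s" for s
  proof -
    have "s = of_int (f s * sgn p) * c"
      using ratio[OF that(1)] p by (auto simp: c_def sgn_if)
    moreover from this have "0 < f s * sgn p"
      using that(2) c by (metis zero_less_mult_pos2 of_int_0_less_iff)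
    ultimately show ?thesis by (intro exI[of _ "nat (f s * sgn p)"]) simp
  qed
  define P where "P n \<longleftrightarrow> 0 < n \<and> of_nat n * c \<in> invertible_degrees" for n :: nat
  have "\<exists>n. P n" using nat_mult[OF assms(2,3)] assms(2) by (auto simp: P_def)
  then have least: "P (Least P)" "\<And>n. P n \<Longrightarrow> Least P \<le> n"
    by (auto intro: LeastI Least_le)
  show ?thesis
  proof (rule that[of "of_nat (Least P) * c"])
    fix k' :: rat assume "k' > 0" "k' \<in> invertible_degrees"
    then obtain n where "n > 0" "k' = of_nat n * c" using nat_mult by blast
    then show "of_nat (Least P) * c \<le> k'"
      using least(2)[of n] \<open>k' \<in> invertible_degrees\<close> c by (simp add: P_def)
  qed (use least c in \<open>auto simp: P_def\<close>)
qed

lemma invertible_degrees_eq_multiples: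
  assumes "k > 0" "k \<in> invertible_degrees" and least: "\<And>k'. k' > 0 \<Longrightarrow> k' \<in> invertible_degrees \<Longrightarrow> k \<le> k'"
  shows "invertible_degrees = multiples k"
proof
  show "multiples k \<subseteq> invertible_degrees" using invertible_of_int_mult[OF assms(2)] by (auto simp: multiples_def)
  show "invertible_degrees \<subseteq> multiples k"
  proof
    fix s assume s: "s \<in> invertible_degrees"
    define j where "j = \<lfloor>s / k\<rfloor>"
    define s' where "s' = s - of_int j * k"
    have "s' \<in> invertible_degrees" unfolding s'_def using invertible_diff[OF s] invertible_of_int_mult[OF assms(2)] by blast
    moreover have "of_int j \<le> s / k" "s / k < of_int j + 1"
      unfolding j_def by linarith+
    then have "0 \<le> s'" "s' < k" using assms(1) by (auto simp: s'_def field_simps)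
    ultimately have "s' = 0" using least[of s'] by force
    then show "s \<in> multiples k" by (auto simp: s'_def multiples_def)
  qed
qed

text \<open>An additive map from the positive rationals to the integers is zero, since its values are
divisible by every positive integer.\<close>

lemma not_additive:
  assumes "f r \<noteq> 0"
  shows "\<exists>g h. 0 < g \<and> 0 < h \<and> (f g + f h \<noteq> f (g + h) \<or> f (- g) + f (- h) \<noteq> f (- g - h))"
proof (rule ccontr)
  assume "\<not> ?thesis"
  then have add: "f (g + h) = f g + f h" "f (- g - h) = f (- g) + f (- h)" if "0 < g" "0 < h" for g h
    using that by force+
  have mult: "f (of_nat n * g) = int n * f g \<and> f (- (of_nat n * g)) = int n * f (- g)" if "0 < g" for n g
  proof (induction n)
    case (Suc n)
    show ?case
    proof (cases "n = 0")
      case False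
      then show ?thesis using Suc add[OF that, of "of_nat n * g"] that by (simp add: algebra_simps)
    qed simp
  qed (simp add: f0)
  have "f g = 0 \<and> f (- g) = 0" if "0 < g" for g
  proof -
    have aux: "x = 0" if "\<And>n. 0 < n \<Longrightarrow> int n dvd x" for x :: int
      using that[of "nat \<bar>x\<bar> + 1"] zdvd_not_zless[of "\<bar>x\<bar>" "\<bar>x\<bar> + 1"] 
      by (metis abs_ge_zero abs_zero add.commute add_pos_nonneg dvd_abs_iff int_nat_eq int_ops(2)
          less_add_one nat_int of_nat_0_less_iff of_nat_add zdvd_not_zless zero_less_abs_iff
          zero_less_one)
    show ?thesis
    proof (intro conjI aux)
      fix n :: nat assume "0 < n"
      then show "int n dvd f g" "int n dvd f (- g)"
        using mult[of "g / of_nat n" n] that by simp_all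
    qed
  qed
  then show False using assms f0 by (metis linorder_neqE_linordered_idom minus_minus neg_0_less_iff_less)
qed

end

section \<open>Additive subgroups of a division ring\<close>

lemma additive_subgrpD:
  assumes "additive_subgrp I"
  shows additive_subgrp_zero: "0 \<in> I"
    and additive_subgrp_diff: "\<And>x y. x \<in> I \<Longrightarrow> y \<in> I \<Longrightarrow> x - y \<in> I"
    and additive_subgrp_uminus: "\<And>x. x \<in> I \<Longrightarrow> - x \<in> I"
    and additive_subgrp_add: "\<And>x y. x \<in> I \<Longrightarrow> y \<in> I \<Longrightarrow> x + y \<in> I"
proof -
  show z: "0 \<in> I" and d: "\<And>x y. x \<in> I \<Longrightarrow> y \<in> I \<Longrightarrow> x - y \<in> I"
    using assms by (auto simp: additive_subgrp_def)
  show u: "\<And>x. x \<in> I \<Longrightarrow> - x \<in> I" using d[OF z] by simp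
  show "\<And>x y. x \<in> I \<Longrightarrow> y \<in> I \<Longrightarrow> x + y \<in> I" using d[OF _ u] by simp
qed

lemma additive_subgrp_sum:
  assumes "additive_subgrp I" "\<And>s. s \<in> T \<Longrightarrow> g s \<in> I"
  shows "sum g T \<in> I"
  using assms(2) by (induction T rule: infinite_finite_induct)
    (auto intro: additive_subgrp_zero[OF assms(1)] additive_subgrp_add[OF assms(1)])

lemma is_subringD:
  assumes "is_subring R"
  shows is_subring_additive: "additive_subgrp R"
    and is_subring_one: "1 \<in> R"
    and is_subring_mult: "\<And>x y. x \<in> R \<Longrightarrow> y \<in> R \<Longrightarrow> x * y \<in> R"
  using assms by (auto simp: is_subring_def)

lemma set_prod_minimal:
  assumes "additive_subgrp L" "\<And>x y. x \<in> I \<Longrightarrow> y \<in> J \<Longrightarrow> x * y \<in> L"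
  shows "set_prod I J \<subseteq> L"
  unfolding set_prod_def by (rule hull_minimal) (use assms in auto)

lemma set_prod_inc: "x \<in> I \<Longrightarrow> y \<in> J \<Longrightarrow> x * y \<in> set_prod I J"
  unfolding set_prod_def by (rule hull_inc) auto

lemma set_prod_eqI:
  assumes "additive_subgrp L" "\<And>x y. x \<in> I \<Longrightarrow> y \<in> J \<Longrightarrow> x * y \<in> L"
    and "\<And>z. z \<in> L \<Longrightarrow> \<exists>x\<in>I. \<exists>y\<in>J. z = x * y"
  shows "set_prod I J = L"
proof
  show "set_prod I J \<subseteq> L" by (rule set_prod_minimal) (fact assms)+
  show "L \<subseteq> set_prod I J"
  proof
    fix z assume "z \<in> L"
    from assms(3)[OF this] obtain x y where "x \<in> I" "y \<in> J" "z = x * y" by fast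
    then show "z \<in> set_prod I J" by (simp add: set_prod_inc)
  qed
qed

lemma r_mult_iff: "a \<noteq> 0 \<Longrightarrow> x \<in> r_mult I a \<longleftrightarrow> x * inverse a \<in> I"
proof
  assume a: "a \<noteq> 0"
  show "x * inverse a \<in> I" if "x \<in> r_mult I a" using that a by (auto simp: r_mult_def mult.assoc)
  assume "x * inverse a \<in> I"
  then have "x * inverse a * a \<in> r_mult I a" unfolding r_mult_def by (rule imageI)
  then show "x \<in> r_mult I a" using a by (simp add: mult.assoc)
qed

lemma l_mult_iff: "a \<noteq> 0 \<Longrightarrow> x \<in> l_mult a I \<longleftrightarrow> inverse a * x \<in> I"
proof
  assume a: "a \<noteq> 0"
  show "inverse a * x \<in> I" if "x \<in> l_mult a I"
    using that a by (auto simp: l_mult_def mult.assoc[symmetric])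
  assume "inverse a * x \<in> I"
  then have "a * (inverse a * x) \<in> l_mult a I" unfolding l_mult_def by (rule imageI)
  then show "x \<in> l_mult a I" using a by (simp add: mult.assoc[symmetric])
qed

lemma r_mult_r_mult: "r_mult (r_mult I a) c = r_mult I (a * c)"
  by (simp add: r_mult_def image_image mult.assoc)

lemma r_mult_1 [simp]: "r_mult I 1 = I"
  by (simp add: r_mult_def)

lemma r_mult_cong_right: "r_mult I x = r_mult I y \<Longrightarrow> r_mult I (x * z) = r_mult I (y * z)"
  by (simp flip: r_mult_r_mult)

lemma additive_subgrp_r_mult: "additive_subgrp I \<Longrightarrow> additive_subgrp (r_mult I a)"
  unfolding additive_subgrp_def r_mult_def
  by (auto simp: left_diff_distrib[symmetric] image_iff)

lemma mem_left_order: "x \<in> left_order I \<longleftrightarrow> (\<forall>y\<in>I. x * y \<in> I)"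
  by (auto simp: left_order_def l_mult_def)

lemma inverse_mult: "a \<noteq> 0 \<Longrightarrow> c \<noteq> 0 \<Longrightarrow> inverse (a * c) = inverse c * inverse (a :: 'a::division_ring)"
  by (rule nonzero_inverse_mult_distrib)

lemma mult_inverse_cancel [simp]:
  fixes a :: "'a::division_ring"
  assumes "a \<noteq> 0"
  shows "a * (inverse a * x) = x" "inverse a * (a * x) = x"
  using assms by (simp_all add: mult.assoc[symmetric])

section \<open>Actions of the rationals\<close>

locale acting_rationals =
  fixes \<sigma> :: "rat \<Rightarrow> 'a::division_ring \<Rightarrow> 'a"
  assumes action: "rat_action \<sigma>"
begin

lemma sigma_add [simp]: "\<sigma> s (x + y) = \<sigma> s x + \<sigma> s y"
  and sigma_mult [simp]: "\<sigma> s (x * y) = \<sigma> s x * \<sigma> s y"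
  and sigma_one [simp]: "\<sigma> s 1 = 1"
  and sigma_bij: "bij (\<sigma> s)"
  and sigma_sigma: "\<sigma> s (\<sigma> t x) = \<sigma> (s + t) x"
  using action by (simp_all add: rat_action_def ring_automorphism_def)

lemma sigma_0 [simp]: "\<sigma> 0 x = x"
proof -
  have "\<sigma> 0 (\<sigma> 0 x) = \<sigma> 0 x" by (simp add: sigma_sigma)
  then show ?thesis using sigma_bij[of 0] by (simp add: bij_def inj_eq)
qed

lemma sigma_zero [simp]: "\<sigma> s 0 = 0"
  using sigma_add[of s 0 0] by simp

lemma sigma_eq_0 [simp]: "\<sigma> s x = 0 \<longleftrightarrow> x = 0"
  using sigma_bij[of s] by (metis bij_def inj_eq sigma_zero)

lemma sigma_inverse [simp]: "\<sigma> s (inverse x) = inverse (\<sigma> s x)"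
proof (cases "x = 0")
  case False
  then have "\<sigma> s x * \<sigma> s (inverse x) = 1" by (simp add: sigma_mult[symmetric] del: sigma_mult)
  from inverse_unique[OF this] show ?thesis by simp
qed simp

lemma sigma_cancel [simp]: "\<sigma> s (\<sigma> (- s) x) = x" "\<sigma> (- s) (\<sigma> s x) = x"
  by (simp_all add: sigma_sigma)

lemma sigma_image_iff: "x \<in> \<sigma> s ` I \<longleftrightarrow> \<sigma> (- s) x \<in> I"
  by (metis imageE imageI sigma_cancel)

end

section \<open>Total valuation rings with principal Jacobson radical\<close>

text \<open>For a total valuation ring this is the unique maximal left ideal, hence the Jacobson radical.\<close>

definition nonunits :: "'a::division_ring set \<Rightarrow> 'a set" where
  "nonunits R = {x \<in> R. x = 0 \<or> inverse x \<notin> R}"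

locale valuation =
  fixes R :: "'a::division_ring set"
  assumes tvr: "total_valuation_ring R"
begin

lemma sub: "is_subring R" and total: "x \<noteq> 0 \<Longrightarrow> x \<notin> R \<Longrightarrow> inverse x \<in> R"
  using tvr by (auto simp: total_valuation_ring_def)

lemmas add_sub = is_subring_additive[OF sub]
lemmas one [simp] = is_subring_one[OF sub]
lemmas zero [simp] = additive_subgrp_zero[OF add_sub]
lemmas mult = is_subring_mult[OF sub]
lemmas diff = additive_subgrp_diff[OF add_sub]

lemma left_ideal_nonunits: "left_ideal R (nonunits R)"
proof -
  have mul: "r * x \<in> nonunits R" if "r \<in> R" "x \<in> nonunits R" for r x
  proof (cases "r * x = 0")
    case False
    have "inverse (r * x) \<notin> R"
    proof
      assume "inverse (r * x) \<in> R"
      then have "inverse (r * x) * r \<in> R" using that mult by blast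
      then show False using that False by (auto simp: nonunits_def inverse_mult mult.assoc)
    qed
    then show ?thesis using that mult by (auto simp: nonunits_def)
  qed (auto simp: nonunits_def)
  have dif: "x - y \<in> nonunits R" if "x \<in> nonunits R" "y \<in> nonunits R" for x y
  proof -
    have *: "x - y \<in> nonunits R \<and> y - x \<in> nonunits R"
      if "x \<in> nonunits R" "y \<in> nonunits R" "y \<noteq> 0" "x * inverse y \<in> R" for x y
      using mul[of "x * inverse y - 1" y] mul[of "1 - x * inverse y" y] diff[OF that(4) one]
        diff[OF one that(4)] that by (simp add: left_diff_distrib mult.assoc)
    show ?thesis
    proof (cases "x = 0 \<or> y = 0")
      case True
      then show ?thesis using that mul[of "- 1"] additive_subgrp_uminus[OF add_sub one]
        by auto
    next
      case False
      then have "x * inverse y \<in> R \<or> y * inverse x \<in> R"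
        using total[of "x * inverse y"] by (auto simp: inverse_mult)
      then show ?thesis using *[of x y] *[of y x] that False by blast
    qed
  qed
  show ?thesis unfolding left_ideal_def additive_subgrp_def
    using mul dif by (auto simp: nonunits_def)
qed

lemma proper_left_ideal_nonunits:
  assumes "left_ideal R L" "L \<noteq> R" shows "L \<subseteq> nonunits R"
proof
  fix x assume x: "x \<in> L"
  have "inverse x \<notin> R" if "x \<noteq> 0"
  proof
    assume "inverse x \<in> R"
    then have "inverse x * x \<in> L" using assms x by (auto simp: left_ideal_def)
    then have "1 \<in> L" using that by simp
    then have "r \<in> L" if "r \<in> R" for r
      using assms(1) that unfolding left_ideal_def by (metis mult.right_neutral)
    then show False using assms by (auto simp: left_ideal_def)
  qed
  then show "x \<in> nonunits R" using assms x by (auto simp: nonunits_def left_ideal_def)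
qed

lemma jacobson_eq_nonunits: "jacobson R = nonunits R"
proof -
  have "1 \<notin> nonunits R" by (simp add: nonunits_def)
  then have ne: "nonunits R \<noteq> R" using one by metis
  have "maximal_left_ideal R L \<longleftrightarrow> L = nonunits R" for L
    unfolding maximal_left_ideal_def
    using left_ideal_nonunits ne proper_left_ideal_nonunits by blast
  then show ?thesis by (auto simp: jacobson_def nonunits_def)
qed

end

locale principal_valuation = acting_rationals \<sigma> + valuation W
  for \<sigma> :: "rat \<Rightarrow> 'a::division_ring \<Rightarrow> 'a" and W :: "'a set" +
  fixes b :: 'a
  assumes b_nz [simp]: "b \<noteq> 0" and jac: "jacobson W = r_mult W (inverse b)"
begin

lemma jac_iff: "x \<in> nonunits W \<longleftrightarrow> x * b \<in> W"
  using jac by (simp add: jacobson_eq_nonunits r_mult_iff)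

lemma b_notin [simp]: "b \<notin> W"
  using jac_iff[of "inverse b"] by (auto simp: nonunits_def)

lemma nonunitsI: "x \<notin> W \<Longrightarrow> inverse x \<in> nonunits W"
  using total[of x] by (cases "x = 0") (auto simp: nonunits_def)

lemma nonunits_mult_right:
  assumes "x \<in> nonunits W" "w \<in> W" shows "x * w \<in> nonunits W"
proof (cases "x * w = 0")
  case False
  have "inverse (x * w) \<notin> W"
  proof
    assume "inverse (x * w) \<in> W"
    then have "w * inverse (x * w) \<in> W" using assms mult by blast
    then show False using assms False
      by (auto simp: nonunits_def inverse_mult mult.assoc[symmetric])
  qed
  then show ?thesis using assms mult by (auto simp: nonunits_def)
qed (auto simp: nonunits_def)

text \<open>The element \<open>inverse b\<close> normalizes \<open>W\<close>. One inclusion holds because the radical is a right ideal.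
If the other failed for \<open>x \<notin> W\<close>, then \<open>inverse b * x\<close> would lie in the radical \<open>J\<close>, and multiplying
it by \<open>inverse x * b\<close>, an element of \<open>W\<close>, would give \<open>1 \<in> J\<close>.\<close>

lemma conj_b: "inverse b * x * b \<in> W \<longleftrightarrow> x \<in> W"
proof
  assume "x \<in> W"
  then show "inverse b * x * b \<in> W"
    using nonunits_mult_right[of "inverse b" x] jac_iff[of "inverse b"] jac_iff[of "inverse b * x"]
    by simp
next
  assume L: "inverse b * x * b \<in> W"
  show "x \<in> W"
  proof (rule ccontr)
    assume "x \<notin> W"
    then have x: "x \<noteq> 0" "inverse x \<in> nonunits W" using nonunitsI[of x] zero by auto
    then have "inverse x * b \<in> W" using jac_iff[of "inverse x"] by simp
    moreover have "inverse b * x \<in> nonunits W" using L jac_iff[of "inverse b * x"] by simp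
    ultimately have "inverse b * x * (inverse x * b) \<in> nonunits W"
      using nonunits_mult_right by blast
    then show False using x by (simp add: mult.assoc nonunits_def)
  qed
qed

lemma jac_iff_left: "x \<in> nonunits W \<longleftrightarrow> b * x \<in> W"
  using conj_b[of "b * x"] jac_iff[of x] by simp

lemma jac_left: "jacobson W = l_mult (inverse b) W"
  by (rule Set.set_eqI) (simp add: jacobson_eq_nonunits l_mult_iff jac_iff_left)

end

section \<open>Normalizing homogeneous units\<close>

context principal_valuation
begin

text \<open>The homogeneous unit \<open>a X\<close> of degree \<open>s\<close> normalizes \<open>W\<close>. Such units form a group, and modulo the
  units of \<open>W\<close> an element of it is determined by its degree and by the left module \<open>r_mult W a\<close>. All
  later computations take place in this quotient, written as equations between sets
  \<open>r_mult W a\<close>.\<close>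

definition normalizing :: "rat \<Rightarrow> 'a \<Rightarrow> bool" where
  "normalizing s a \<longleftrightarrow> a \<noteq> 0 \<and> (\<forall>x. a * \<sigma> s x * inverse a \<in> W \<longleftrightarrow> x \<in> W)"

lemma normalizing_nz: "normalizing s a \<Longrightarrow> a \<noteq> 0"
  and normalizing_iff: "normalizing s a \<Longrightarrow> a * \<sigma> s x * inverse a \<in> W \<longleftrightarrow> x \<in> W"
  by (auto simp: normalizing_def)

lemma normalizing_sets:
  assumes "a \<noteq> 0"
  shows "normalizing s a \<longleftrightarrow> r_mult W a = l_mult a (\<sigma> s ` W)"
proof -
  have "r_mult W a = l_mult a (\<sigma> s ` W) \<longleftrightarrow> (\<forall>x. a * \<sigma> s x \<in> r_mult W a \<longleftrightarrow> a * \<sigma> s x \<in> l_mult a (\<sigma> s ` W))"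
    (is "_ \<longleftrightarrow> ?R")
  proof
    assume ?R
    have "\<exists>x. z = a * \<sigma> s x" for z
      by (rule exI[of _ "\<sigma> (- s) (inverse a * z)"]) (use assms in \<open>simp add: mult.assoc[symmetric] del: sigma_mult\<close>)
    then show "r_mult W a = l_mult a (\<sigma> s ` W)" using \<open>?R\<close> by (metis Set.set_eqI)
  qed simp
  then show ?thesis
    using assms by (simp add: normalizing_def r_mult_iff l_mult_iff sigma_image_iff)
qed

lemma normalizing_mult:
  assumes "normalizing s a" "normalizing t c"
  shows "normalizing (s + t) (a * \<sigma> s c)"
  unfolding normalizing_def
proof (intro conjI allI)
  have nz: "a \<noteq> 0" "c \<noteq> 0" using assms by (auto simp: normalizing_def)
  then show "a * \<sigma> s c \<noteq> 0" by simp
  fix x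
  have "a * \<sigma> s c * \<sigma> (s + t) x * inverse (a * \<sigma> s c)
      = a * \<sigma> s (c * \<sigma> t x * inverse c) * inverse a"
    using nz by (simp add: inverse_mult sigma_sigma mult.assoc)
  then show "a * \<sigma> s c * \<sigma> (s + t) x * inverse (a * \<sigma> s c) \<in> W \<longleftrightarrow> x \<in> W"
    using assms by (simp only: normalizing_iff)
qed

lemma normalizing_quotient:
  assumes a: "normalizing s a" and ac: "normalizing (s + t) (a * \<sigma> s c)"
  shows "normalizing t c"
  unfolding normalizing_def
proof (intro conjI allI)
  show nz: "c \<noteq> 0" using ac by (auto simp: normalizing_def)
  have nza: "a \<noteq> 0" using a by (auto simp: normalizing_def)
  fix x
  have "a * \<sigma> s c * \<sigma> (s + t) x * inverse (a * \<sigma> s c)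
      = a * \<sigma> s (c * \<sigma> t x * inverse c) * inverse a"
    using nz nza by (simp add: inverse_mult sigma_sigma mult.assoc)
  then show "c * \<sigma> t x * inverse c \<in> W \<longleftrightarrow> x \<in> W"
    using normalizing_iff[OF ac] normalizing_iff[OF a] by metis
qed

lemma r_mult_subset_iff:
  assumes "x \<noteq> 0" "y \<noteq> 0"
  shows "r_mult W x \<subseteq> r_mult W y \<longleftrightarrow> x * inverse y \<in> W"
proof
  assume "r_mult W x \<subseteq> r_mult W y"
  then have "x \<in> r_mult W y" using assms by (auto simp: r_mult_iff subset_iff)
  then show "x * inverse y \<in> W" using assms by (simp add: r_mult_iff)
next
  assume L: "x * inverse y \<in> W"
  show "r_mult W x \<subseteq> r_mult W y"
  proof
    fix z assume "z \<in> r_mult W x"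
    then have "z * inverse x \<in> W" using assms by (simp add: r_mult_iff)
    then have "z * inverse x * (x * inverse y) \<in> W" using mult L by blast
    then show "z \<in> r_mult W y" using assms by (simp add: r_mult_iff mult.assoc)
  qed
qed

lemma r_mult_mem_subset: "x \<in> r_mult W y \<Longrightarrow> y \<noteq> 0 \<Longrightarrow> r_mult W x \<subseteq> r_mult W y"
  using mult by (auto simp: r_mult_def mult.assoc[symmetric])

lemma r_mult_self: "x \<in> r_mult W x"
  unfolding r_mult_def by (rule image_eqI[of _ _ 1]) simp_all

lemma W_r_mult: "w \<in> W \<Longrightarrow> x \<in> r_mult W c \<Longrightarrow> w * x \<in> r_mult W c"
  using mult by (auto simp: r_mult_def mult.assoc[symmetric])

lemma r_mult_zero_eq: "r_mult W x = r_mult W y \<Longrightarrow> x = 0 \<longleftrightarrow> y = 0"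
  using r_mult_self[of x] r_mult_self[of y] by (auto simp: r_mult_def[of _ 0])

lemma r_mult_eq_iff:
  assumes "x \<noteq> 0" "y \<noteq> 0"
  shows "r_mult W x = r_mult W y \<longleftrightarrow> x * inverse y \<in> W \<and> y * inverse x \<in> W"
  using r_mult_subset_iff[OF assms] r_mult_subset_iff[OF assms(2,1)] by blast

lemma normalizing_mult_mem:
  assumes "normalizing s a" "c \<noteq> 0"
  shows "a * \<sigma> s x \<in> r_mult W (a * \<sigma> s c) \<longleftrightarrow> x \<in> r_mult W c"
proof -
  have "a \<noteq> 0" using assms by (simp add: normalizing_def)
  then have "a * \<sigma> s x * inverse (a * \<sigma> s c) = a * \<sigma> s (x * inverse c) * inverse a"
    using assms by (simp add: inverse_mult mult.assoc)
  then have "a * \<sigma> s x * inverse (a * \<sigma> s c) \<in> W \<longleftrightarrow> x * inverse c \<in> W"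
    using normalizing_iff[OF assms(1)] by (simp only:)
  then show ?thesis using assms(2) \<open>a \<noteq> 0\<close> by (simp add: r_mult_iff)
qed

lemma r_mult_cong_left:
  assumes "normalizing s a" "r_mult W c = r_mult W d"
  shows "r_mult W (a * \<sigma> s c) = r_mult W (a * \<sigma> s d)"
proof (cases "c = 0")
  case True
  then show ?thesis using r_mult_zero_eq[OF assms(2)] by simp
next
  case False
  then have d: "d \<noteq> 0" using r_mult_zero_eq[OF assms(2)] by simp
  have "a \<noteq> 0" using assms(1) by (simp add: normalizing_def)
  have "a * \<sigma> s c \<in> r_mult W (a * \<sigma> s d)" "a * \<sigma> s d \<in> r_mult W (a * \<sigma> s c)"
    using normalizing_mult_mem[OF assms(1)] False d assms(2) r_mult_self by blast+
  then show ?thesis using r_mult_mem_subset \<open>a \<noteq> 0\<close> False d by (intro antisym) auto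
qed

lemma normalizing_cong:
  assumes "normalizing s a" "r_mult W c = r_mult W a"
  shows "normalizing s c"
proof -
  have nz: "a \<noteq> 0" "c \<noteq> 0" using assms r_mult_zero_eq[OF assms(2)] by (auto simp: normalizing_def)
  define u where "u = c * inverse a"
  have u: "u \<in> W" "inverse u \<in> W" "c = u * a" "u \<noteq> 0"
    using assms(2) r_mult_eq_iff[OF nz(2,1)] nz by (auto simp: u_def inverse_mult mult.assoc)
  show ?thesis unfolding normalizing_def
  proof (intro conjI allI)
    fix x
    let ?y = "a * \<sigma> s x * inverse a"
    have "c * \<sigma> s x * inverse c = u * ?y * inverse u" using nz u by (simp add: inverse_mult mult.assoc)
    moreover have "u * ?y * inverse u \<in> W \<longleftrightarrow> ?y \<in> W"
    proof
      assume "u * ?y * inverse u \<in> W"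
      then have "inverse u * (u * ?y * inverse u) * u \<in> W" using u mult by blast
      then show "?y \<in> W" using u by (simp add: mult.assoc)
    qed (use u mult in blast)
    ultimately show "c * \<sigma> s x * inverse c \<in> W \<longleftrightarrow> x \<in> W" using normalizing_iff[OF assms(1)] by simp
  qed (use nz in simp)
qed

lemma normalizing_nonunits:
  assumes "normalizing s a"
  shows "a * \<sigma> s x * inverse a \<in> nonunits W \<longleftrightarrow> x \<in> nonunits W"
proof -
  have "a \<noteq> 0" using assms by (simp add: normalizing_def)
  then have "inverse (a * \<sigma> s x * inverse a) = a * \<sigma> s (inverse x) * inverse a" if "x \<noteq> 0"
    using that by (simp add: inverse_mult mult.assoc)
  then show ?thesis using normalizing_iff[OF assms, of x] normalizing_iff[OF assms, of "inverse x"] \<open>a \<noteq> 0\<close>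
    by (cases "x = 0") (auto simp: nonunits_def)
qed

lemma normalizing_b: "normalizing 0 (inverse b)"
  using conj_b by (simp add: normalizing_def)

lemma powi_b_nz [simp]: "b powi e \<noteq> 0" by simp

lemma powi_b_add: "b powi (e + e') = b powi e * b powi e'"
  by (simp add: power_int_add)

lemma normalizing_one: "normalizing 0 1"
  by (simp add: normalizing_def)

lemma normalizing_powi_b: "normalizing 0 (b powi e)"
proof -
  have b': "normalizing 0 b"
    using normalizing_quotient[OF normalizing_b, of 0 b] normalizing_one by simp
  have "normalizing 0 (b ^ n)" "normalizing 0 (inverse b ^ n)" for n
  proof (induction n)
    case (Suc n)
    show "normalizing 0 (b ^ Suc n)" "normalizing 0 (inverse b ^ Suc n)"
      using normalizing_mult[OF b' Suc(1)] normalizing_mult[OF normalizing_b Suc(2)] by simp_all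
  qed (simp_all add: normalizing_one)
  then show ?thesis by (simp add: power_int_def)
qed

text \<open>The powers of \<open>b\<close> give a copy of the integers in the group of classes, ordered as the integers.\<close>

lemma powi_b_mem: "b powi e \<in> W \<longleftrightarrow> e \<le> 0"
proof -
  have neg: "inverse b ^ n \<in> W" for n
    using jac_iff[of "inverse b"] by (induction n) (auto simp: mult nonunits_def)
  have pos: "b ^ Suc n \<notin> W" for n
  proof
    assume "b ^ Suc n \<in> W"
    then have "b * b ^ n * inverse b ^ n \<in> W" using neg mult by fastforce
    then show False by (simp add: mult.assoc power_inverse)
  qed
  show ?thesis
  proof (cases "e \<le> 0")
    case True
    then show ?thesis using neg[of "nat (- e)"] by (cases "e = 0") (auto simp: power_int_def)
  next
    case False
    then show ?thesis using pos[of "nat e - 1"] by (simp add: power_int_def)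
  qed
qed

lemma powi_b_subset_iff:
  assumes "x \<noteq> 0"
  shows "r_mult W (b powi e * x) \<subseteq> r_mult W (b powi e' * x) \<longleftrightarrow> e \<le> e'"
proof -
  have "b powi e * inverse (b powi e') = b powi (e - e')"
    using power_int_add[of b e "- e'"] by (simp add: power_int_minus)
  then have "b powi e * x * inverse (b powi e' * x) = b powi (e - e')"
    using assms by (simp add: inverse_mult mult.assoc)
  then show ?thesis using assms powi_b_mem[of "e - e'"] by (subst r_mult_subset_iff) auto
qed

lemma powi_b_eq_iff:
  assumes "x \<noteq> 0"
  shows "r_mult W (b powi e * x) = r_mult W (b powi e' * x) \<longleftrightarrow> e = e'"
  using powi_b_subset_iff[OF assms] by (metis antisym order_refl)

text \<open>The class of \<open>b\<close> is central: conjugation by a normalizing element maps \<open>W\<close> to itself, hence also the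
radical, hence the class of \<open>inverse b\<close>, which generates it.\<close>

lemma b_central:
  assumes a: "normalizing s a"
  shows "r_mult W (a * \<sigma> s (b powi e)) = r_mult W (b powi e * a)"
proof -
  have nz: "a \<noteq> 0" using a by (simp add: normalizing_def)
  let ?c = "a * \<sigma> s (inverse b) * inverse a"
  have "x * b \<in> W \<longleftrightarrow> x * inverse ?c \<in> W" for x
  proof -
    define y where "y = \<sigma> (- s) (inverse a * x * a)"
    have x: "x = a * \<sigma> s y * inverse a"
      unfolding y_def sigma_cancel using nz by (simp add: mult.assoc)
    have "x * inverse ?c = a * \<sigma> s (y * b) * inverse a"
      using nz x by (simp add: inverse_mult mult.assoc)
    then have "x * inverse ?c \<in> W \<longleftrightarrow> y \<in> nonunits W"
      by (simp only: normalizing_iff[OF a] jac_iff)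
    also have "\<dots> \<longleftrightarrow> x \<in> nonunits W" using normalizing_nonunits[OF a] x by simp
    finally show ?thesis using jac_iff by simp
  qed
  note c = this
  have step: "r_mult W (a * \<sigma> s (inverse b)) = r_mult W (inverse b * a)"
  proof -
    have "r_mult W ?c = r_mult W (inverse b)"
      using c nz by (auto simp: r_mult_iff simp del: sigma_inverse)
    from r_mult_cong_right[OF this, of a] show ?thesis using nz by (simp add: mult.assoc)
  qed
  have stepb: "r_mult W (a * \<sigma> s b) = r_mult W (b * a)"
  proof -
    have "r_mult W (a * \<sigma> s (inverse b) * \<sigma> s b) = r_mult W (inverse b * a * \<sigma> s b)"
      by (rule r_mult_cong_right[OF step])
    then have "r_mult W a = r_mult W (inverse b * (a * \<sigma> s b))"
      by (simp add: mult.assoc)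
    from r_mult_cong_left[OF normalizing_powi_b[of 1] this] show ?thesis by simp
  qed
  have gen: "r_mult W (a * \<sigma> s (c ^ n)) = r_mult W (c ^ n * a)"
    if "r_mult W (a * \<sigma> s c) = r_mult W (c * a)" "\<And>n. normalizing 0 (c ^ n)" for c n
  proof (induction n)
    case (Suc n)
    have "r_mult W (a * \<sigma> s (c ^ n) * \<sigma> s c) = r_mult W (c ^ n * a * \<sigma> s c)"
      by (rule r_mult_cong_right[OF Suc])
    moreover have "r_mult W (c ^ n * (a * \<sigma> s c)) = r_mult W (c ^ n * (c * a))"
      using r_mult_cong_left[OF that(2) that(1)] by simp
    moreover have "c ^ Suc n = c ^ n * c" by (simp add: power_commutes)
    ultimately show ?case by (simp only: sigma_mult mult.assoc)
  qed simp
  have nb: "normalizing 0 (b ^ n)" "normalizing 0 (inverse b ^ n)" for n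
    using normalizing_powi_b[of "int n"] normalizing_powi_b[of "- int n"]
    by (auto simp: power_int_def power_inverse split: if_splits)
  show ?thesis
    using gen[OF stepb nb(1), of "nat e"] gen[OF step nb(2), of "nat (- e)"] by (simp add: power_int_def)
qed

lemma b_shift:
  assumes "normalizing s a" "r_mult W x = r_mult W (b powi e * y)"
  shows "r_mult W (a * \<sigma> s x) = r_mult W (b powi e * (a * \<sigma> s y))"
proof -
  have "r_mult W (a * \<sigma> s x) = r_mult W (a * \<sigma> s (b powi e * y))"
    by (rule r_mult_cong_left[OF assms])
  also have "\<dots> = r_mult W (a * \<sigma> s (b powi e) * \<sigma> s y)" by (simp add: mult.assoc)
  also have "\<dots> = r_mult W (b powi e * a * \<sigma> s y)" by (rule r_mult_cong_right[OF b_central[OF assms(1)]])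
  finally show ?thesis by (simp add: mult.assoc)
qed

lemma r_mult_powi_cong:
  assumes "r_mult W x = r_mult W y" shows "r_mult W (b powi e * x) = r_mult W (b powi e * y)"
  using r_mult_cong_left[OF normalizing_powi_b assms] by simp

text \<open>No left module lies strictly between \<open>W\<close> and its radical. This discreteness is what makes the
cocycle of a graded extension take only two values.\<close>

lemma r_mult_split:
  assumes "x \<noteq> 0" "x \<in> W" "inverse b * inverse x \<in> W"
  shows "r_mult W x = W \<or> r_mult W x = r_mult W (inverse b)"
proof (cases "inverse x \<in> W")
  case True
  then show ?thesis using assms r_mult_eq_iff[of x 1] by simp
next
  case False
  then have "x * b \<in> W" using assms jac_iff[of x] by (auto simp: nonunits_def)
  then show ?thesis using assms r_mult_eq_iff[of x "inverse b"] by simp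
qed

lemma set_prod_normalizing:
  assumes "normalizing s a"
  shows "set_prod (r_mult W a) (\<sigma> s ` r_mult W c) = r_mult W (a * \<sigma> s c)"
proof (rule set_prod_eqI)
  show "additive_subgrp (r_mult W (a * \<sigma> s c))" by (intro additive_subgrp_r_mult add_sub)
  have nz: "a \<noteq> 0" using assms by (simp add: normalizing_def)
  fix x y assume "x \<in> r_mult W a" "y \<in> \<sigma> s ` r_mult W c"
  then obtain w w' where w: "w \<in> W" "w' \<in> W" "x = w * a" "y = \<sigma> s w' * \<sigma> s c"
    by (auto simp: r_mult_def)
  have "x * y = w * (a * \<sigma> s w' * inverse a) * (a * \<sigma> s c)"
    using nz w by (simp add: mult.assoc)
  then show "x * y \<in> r_mult W (a * \<sigma> s c)"
    using w normalizing_iff[OF assms, of w'] mult unfolding r_mult_def by blast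
next
  fix z assume "z \<in> r_mult W (a * \<sigma> s c)"
  then obtain w where "w \<in> W" "z = w * a * \<sigma> s c" by (auto simp: r_mult_def mult.assoc)
  then have "w * a \<in> r_mult W a" "\<sigma> s c \<in> \<sigma> s ` r_mult W c" "z = w * a * \<sigma> s c"
    using r_mult_self[of c] by (auto simp: r_mult_def)
  then show "\<exists>x\<in>r_mult W a. \<exists>y\<in>\<sigma> s ` r_mult W c. z = x * y" by fast
qed

lemma left_order_r_mult: assumes "a \<noteq> 0" shows "left_order (r_mult W a) = W"
proof -
  have "x \<in> left_order (r_mult W a) \<longleftrightarrow> x \<in> W" for x
  proof
    assume "x \<in> left_order (r_mult W a)"
    then have "x * a \<in> r_mult W a" using r_mult_self by (auto simp: mem_left_order)
    then show "x \<in> W" using assms by (simp add: r_mult_iff mult.assoc)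
  qed (auto simp: mem_left_order r_mult_def mult mult.assoc[symmetric])
  then show ?thesis by blast
qed

end

section \<open>Graded subrings in coordinates\<close>

lemma skew_group_ring_simps [simp]:
  "carrier (skew_group_ring G \<sigma>) = {x. finite {g. x g \<noteq> 0} \<and> {g. x g \<noteq> 0} \<subseteq> G}"
  "x \<otimes>\<^bsub>skew_group_ring G \<sigma>\<^esub> y = (\<lambda>t. \<Sum>s | x s \<noteq> 0. x s * \<sigma> s (y (t - s)))"
  "\<one>\<^bsub>skew_group_ring G \<sigma>\<^esub> = homog 1 0"
  "\<zero>\<^bsub>skew_group_ring G \<sigma>\<^esub> = (\<lambda>_. 0)"
  "x \<oplus>\<^bsub>skew_group_ring G \<sigma>\<^esub> y = (\<lambda>t. x t + y t)"
  by (simp_all add: skew_group_ring_def)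

lemma homog_support: "{h. homog a g h \<noteq> 0} = (if a = 0 then {} else {g})"
  by (auto simp: homog_def)

lemma homog_carrier: "g \<in> G \<Longrightarrow> homog a g \<in> carrier (skew_group_ring G \<sigma>)"
  by (simp add: homog_support)

lemma homog_in_graded_sum:
  assumes "\<And>h. h \<in> G \<Longrightarrow> 0 \<in> A h" "g \<in> G"
  shows "homog a g \<in> graded_sum G \<sigma> A \<longleftrightarrow> a \<in> A g"
  using assms homog_carrier[OF assms(2)] by (auto simp: graded_sum_def homog_def)

lemma add_inverse_skew_group_ring:
  assumes "x \<in> carrier (skew_group_ring G \<sigma>)"
  shows "inv\<^bsub>add_monoid (skew_group_ring G \<sigma>)\<^esub> x = (\<lambda>t. - x t)"
  unfolding m_inv_def
proof (rule the_equality)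
  show "(\<lambda>t. - x t) \<in> carrier (add_monoid (skew_group_ring G \<sigma>)) \<and>
    x \<otimes>\<^bsub>add_monoid (skew_group_ring G \<sigma>)\<^esub> (\<lambda>t. - x t) = \<one>\<^bsub>add_monoid (skew_group_ring G \<sigma>)\<^esub> \<and>
    (\<lambda>t. - x t) \<otimes>\<^bsub>add_monoid (skew_group_ring G \<sigma>)\<^esub> x = \<one>\<^bsub>add_monoid (skew_group_ring G \<sigma>)\<^esub>"
    using assms by simp
next
  fix y
  assume "y \<in> carrier (add_monoid (skew_group_ring G \<sigma>)) \<and>
    x \<otimes>\<^bsub>add_monoid (skew_group_ring G \<sigma>)\<^esub> y = \<one>\<^bsub>add_monoid (skew_group_ring G \<sigma>)\<^esub> \<and>
    y \<otimes>\<^bsub>add_monoid (skew_group_ring G \<sigma>)\<^esub> x = \<one>\<^bsub>add_monoid (skew_group_ring G \<sigma>)\<^esub>"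
  then have "(\<lambda>t. x t + y t) = (\<lambda>_. 0)" by simp
  then show "y = (\<lambda>t. - x t)" by (metis eq_neg_iff_add_eq_0 add.commute ext)
qed

lemma graded_sum_additive:
  assumes "subgroup (graded_sum G \<sigma> A) (add_monoid (skew_group_ring G \<sigma>))" "g \<in> G"
  shows "additive_subgrp (A g)"
proof -
  have "\<one>\<^bsub>add_monoid (skew_group_ring G \<sigma>)\<^esub> \<in> graded_sum G \<sigma> A"
    by (rule subgroup.one_closed[OF assms(1)])
  then have zero: "0 \<in> A h" if "h \<in> G" for h using that by (simp add: graded_sum_def)
  have iff: "homog x g \<in> graded_sum G \<sigma> A \<longleftrightarrow> x \<in> A g" for x
    by (rule homog_in_graded_sum) (fact zero assms(2))+
  show ?thesis unfolding additive_subgrp_def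
  proof (intro conjI ballI)
    fix x y assume "x \<in> A g" "y \<in> A g"
    then have mem: "homog x g \<in> graded_sum G \<sigma> A" "homog y g \<in> graded_sum G \<sigma> A"
      by (simp_all add: iff)
    have "homog x g \<otimes>\<^bsub>add_monoid (skew_group_ring G \<sigma>)\<^esub>
      inv\<^bsub>add_monoid (skew_group_ring G \<sigma>)\<^esub> homog y g \<in> graded_sum G \<sigma> A"
      by (intro subgroup.m_closed[OF assms(1)] subgroup.m_inv_closed[OF assms(1)] mem)
    moreover have "homog x g \<otimes>\<^bsub>add_monoid (skew_group_ring G \<sigma>)\<^esub>
      inv\<^bsub>add_monoid (skew_group_ring G \<sigma>)\<^esub> homog y g = homog (x - y) g"
      unfolding add_inverse_skew_group_ring[OF homog_carrier[OF assms(2)]]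
      by (simp add: homog_def fun_eq_iff)
    ultimately show "x - y \<in> A g" by (simp add: iff)
  qed (rule zero[OF assms(2)])
qed

context acting_rationals
begin

lemma homog_mult:
  "homog a g \<otimes>\<^bsub>skew_group_ring G \<sigma>\<^esub> y = (\<lambda>t. a * \<sigma> g (y (t - g)))"
proof (cases "a = 0")
  case False
  then have "{s. homog a g s \<noteq> 0} = {g}" "homog a g g = a" by (auto simp: homog_def)
  then show ?thesis by simp
qed (simp add: homog_support)

lemma homog_mult_homog:
  "homog a g \<otimes>\<^bsub>skew_group_ring G \<sigma>\<^esub> homog c h = homog (a * \<sigma> g c) (g + h)"
  unfolding homog_mult by (auto simp: homog_def fun_eq_iff algebra_simps)

text \<open>A right inverse of a homogeneous element is determined coefficient by coefficient, so the inverse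
is found without knowing that the skew group ring is associative.\<close>

lemma inv_homog:
  assumes "a \<noteq> 0" "- g \<in> G"
  shows "inv\<^bsub>skew_group_ring G \<sigma>\<^esub> (homog a g) = homog (\<sigma> (- g) (inverse a)) (- g)"
  unfolding m_inv_def
proof (rule the_equality)
  show "homog (\<sigma> (- g) (inverse a)) (- g) \<in> carrier (skew_group_ring G \<sigma>) \<and>
    homog a g \<otimes>\<^bsub>skew_group_ring G \<sigma>\<^esub> homog (\<sigma> (- g) (inverse a)) (- g) = \<one>\<^bsub>skew_group_ring G \<sigma>\<^esub> \<and>
    homog (\<sigma> (- g) (inverse a)) (- g) \<otimes>\<^bsub>skew_group_ring G \<sigma>\<^esub> homog a g = \<one>\<^bsub>skew_group_ring G \<sigma>\<^esub>"
    using assms homog_carrier[OF assms(2)] unfolding homog_mult_homog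
    by (simp flip: sigma_mult sigma_inverse)
next
  fix y
  assume "y \<in> carrier (skew_group_ring G \<sigma>) \<and>
    homog a g \<otimes>\<^bsub>skew_group_ring G \<sigma>\<^esub> y = \<one>\<^bsub>skew_group_ring G \<sigma>\<^esub> \<and>
    y \<otimes>\<^bsub>skew_group_ring G \<sigma>\<^esub> homog a g = \<one>\<^bsub>skew_group_ring G \<sigma>\<^esub>"
  then have y: "a * \<sigma> g (y (t - g)) = homog 1 0 t" for t
    unfolding homog_mult by (simp add: fun_eq_iff)
  show "y = homog (\<sigma> (- g) (inverse a)) (- g)"
  proof
    fix s
    have "\<sigma> g (y s) = inverse a * (a * \<sigma> g (y ((s + g) - g)))" using assms(1) by simp
    also have "\<dots> = inverse a * homog 1 0 (s + g)" by (simp only: y)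
    finally have "y s = \<sigma> (- g) (inverse a * homog 1 0 (s + g))" by (metis sigma_cancel(2))
    then show "y s = homog (\<sigma> (- g) (inverse a)) (- g) s"
      by (auto simp: homog_def add_eq_0_iff2)
  qed
qed

text \<open>The conditions on the components alone that make the direct sum over \<open>G\<close> a graded extension of
\<open>V\<close>.\<close>

definition graded_family :: "rat set \<Rightarrow> 'a set \<Rightarrow> (rat \<Rightarrow> 'a set) \<Rightarrow> bool" where
  "graded_family G V A \<longleftrightarrow> (\<forall>g\<in>G. additive_subgrp (A g)) \<and> 1 \<in> A 0 \<and>
     (\<forall>g\<in>G. \<forall>h\<in>G. \<forall>x\<in>A g. \<forall>y\<in>A h. x * \<sigma> g y \<in> A (g + h)) \<and>
     (\<forall>g\<in>G. \<forall>x. x \<noteq> 0 \<longrightarrow> x \<in> A g \<or> \<sigma> (- g) (inverse x) \<in> A (- g)) \<and> A 0 = V"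

lemma graded_extension_iff:
  assumes G: "0 \<in> G" "\<And>g. g \<in> G \<Longrightarrow> - g \<in> G" "\<And>g h. g \<in> G \<Longrightarrow> h \<in> G \<Longrightarrow> g + h \<in> G"
  shows "graded_extension G \<sigma> V A \<longleftrightarrow> graded_family G V A"
proof
  let ?R = "skew_group_ring G \<sigma>" and ?S = "graded_sum G \<sigma> A"
  assume ext: "graded_extension G \<sigma> V A"
  then have sub: "subring ?S ?R" and tot: "\<And>g x. g \<in> G \<Longrightarrow> x \<noteq> 0 \<Longrightarrow> homog x g \<in> ?S \<or> inv\<^bsub>?R\<^esub> (homog x g) \<in> ?S"
    and A0: "A 0 = V"
    by (auto simp: graded_extension_def graded_total_valuation_ring_def)
  have add: "additive_subgrp (A g)" if "g \<in> G" for g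
    using graded_sum_additive sub that by (auto simp: subring_def)
  have zero: "0 \<in> A g" if "g \<in> G" for g using add[OF that] by (rule additive_subgrp_zero)
  have mem: "homog x g \<in> ?S \<longleftrightarrow> x \<in> A g" if "g \<in> G" for g x
    by (rule homog_in_graded_sum) (fact zero that)+
  show "graded_family G V A" unfolding graded_family_def
  proof (intro conjI ballI allI impI)
    show "1 \<in> A 0" using subringE(3)[OF sub] mem[OF G(1)] by simp
    fix g h x y assume "g \<in> G" "h \<in> G" "x \<in> A g" "y \<in> A h"
    then have "homog x g \<otimes>\<^bsub>?R\<^esub> homog y h \<in> ?S"
      by (intro subringE(6)[OF sub]) (simp_all add: mem)
    then show "x * \<sigma> g y \<in> A (g + h)"
      unfolding homog_mult_homog using mem[OF G(3)] \<open>g \<in> G\<close> \<open>h \<in> G\<close> by simp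
  next
    fix g x assume "g \<in> G" "x \<noteq> (0::'a)"
    then show "x \<in> A g \<or> \<sigma> (- g) (inverse x) \<in> A (- g)"
      using tot[of g x] mem[of g x] mem[OF G(2)] inv_homog[of x g G] G(2) by auto
  qed (auto simp: add A0)
next
  let ?R = "skew_group_ring G \<sigma>" and ?S = "graded_sum G \<sigma> A"
  assume fam: "graded_family G V A"
  then have add: "\<And>g. g \<in> G \<Longrightarrow> additive_subgrp (A g)" and one: "1 \<in> A 0"
    and mul: "\<And>g h x y. g \<in> G \<Longrightarrow> h \<in> G \<Longrightarrow> x \<in> A g \<Longrightarrow> y \<in> A h \<Longrightarrow> x * \<sigma> g y \<in> A (g + h)"
    and tot: "\<And>g x. g \<in> G \<Longrightarrow> x \<noteq> 0 \<Longrightarrow> x \<in> A g \<or> \<sigma> (- g) (inverse x) \<in> A (- g)" and A0: "A 0 = V"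
    by (auto simp: graded_family_def)
  have zero: "0 \<in> A g" if "g \<in> G" for g using add[OF that] by (rule additive_subgrp_zero)
  have finS: "finite {g. x g \<noteq> 0}" and suppS: "x g \<noteq> 0 \<Longrightarrow> g \<in> G" and memS: "g \<in> G \<Longrightarrow> x g \<in> A g"
    if "x \<in> ?S" for x g
    using that by (auto simp: graded_sum_def)
  have SI: "x \<in> ?S" if "finite {g. x g \<noteq> 0}" "\<And>g. x g \<noteq> 0 \<Longrightarrow> g \<in> G" "\<And>g. g \<in> G \<Longrightarrow> x g \<in> A g" for x
    using that by (auto simp: graded_sum_def)
  have mem: "homog x g \<in> ?S \<longleftrightarrow> x \<in> A g" if "g \<in> G" for g x
    by (rule homog_in_graded_sum) (fact zero that)+
  have "subgroup ?S (add_monoid ?R)"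
  proof
    show "?S \<subseteq> carrier (add_monoid ?R)" by (auto simp: graded_sum_def)
    fix x y assume xy: "x \<in> ?S" "y \<in> ?S"
    have "(\<lambda>t. x t + y t) \<in> ?S"
    proof (rule SI)
      show "finite {g. x g + y g \<noteq> 0}"
        by (rule finite_subset[of _ "{g. x g \<noteq> 0} \<union> {g. y g \<noteq> 0}"]) (use xy finS in auto)
      show "g \<in> G" if "x g + y g \<noteq> 0" for g
        using that suppS[OF xy(1), of g] suppS[OF xy(2), of g] by (cases "x g = 0") auto
      show "x g + y g \<in> A g" if "g \<in> G" for g
        using additive_subgrp_add[OF add] memS xy that by blast
    qed
    then show "x \<otimes>\<^bsub>add_monoid ?R\<^esub> y \<in> ?S" by simp
  next
    fix x assume x: "x \<in> ?S"
    have "(\<lambda>t. - x t) \<in> ?S"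
      by (rule SI) (use x finS suppS additive_subgrp_uminus[OF add] memS in auto)
    moreover have "x \<in> carrier ?R" using x unfolding graded_sum_def by blast
    ultimately show "inv\<^bsub>add_monoid ?R\<^esub> x \<in> ?S" by (simp only: add_inverse_skew_group_ring)
  qed (auto simp: graded_sum_def zero)
  moreover have "submonoid ?S ?R"
  proof
    show "?S \<subseteq> carrier ?R" by (auto simp: graded_sum_def)
    show "\<one>\<^bsub>?R\<^esub> \<in> ?S" using mem[OF G(1), of 1] one by simp
    fix x y assume xy: "x \<in> ?S" "y \<in> ?S"
    have "(\<lambda>t. \<Sum>s | x s \<noteq> 0. x s * \<sigma> s (y (t - s))) \<in> ?S" (is "?z \<in> _")
    proof (rule SI)
      have ex: "\<exists>s. x s \<noteq> 0 \<and> y (t - s) \<noteq> 0" if "?z t \<noteq> 0" for t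
      proof (rule ccontr)
        assume "\<not> ?thesis"
        then have "?z t = 0" by (intro sum.neutral) auto
        then show False using that by simp
      qed
      show "finite {t. ?z t \<noteq> 0}"
      proof (rule finite_subset)
        show "finite ((\<lambda>(s, u). s + u) ` ({s. x s \<noteq> 0} \<times> {u. y u \<noteq> 0}))"
          using finS xy by (intro finite_imageI finite_cartesian_product) auto
        show "{t. ?z t \<noteq> 0} \<subseteq> (\<lambda>(s, u). s + u) ` ({s. x s \<noteq> 0} \<times> {u. y u \<noteq> 0})"
        proof
          fix t assume "t \<in> {t. ?z t \<noteq> 0}"
          then obtain s where "x s \<noteq> 0" "y (t - s) \<noteq> 0" using ex by auto
          then show "t \<in> (\<lambda>(s, u). s + u) ` ({s. x s \<noteq> 0} \<times> {u. y u \<noteq> 0})"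
            by (intro image_eqI[of _ _ "(s, t - s)"]) auto
        qed
      qed
      show "t \<in> G" if "?z t \<noteq> 0" for t
        using ex[OF that] suppS[OF xy(1)] suppS[OF xy(2)] G(3) by (metis add.commute diff_add_cancel)
      show "?z t \<in> A t" if t: "t \<in> G" for t
      proof (rule additive_subgrp_sum[OF add[OF t]])
        fix s assume "s \<in> {s. x s \<noteq> 0}"
        then have s: "s \<in> G" using suppS[OF xy(1)] by auto
        then have "t - s \<in> G" using G(3)[OF t G(2)[OF s]] by simp
        then show "x s * \<sigma> s (y (t - s)) \<in> A t"
          using mul[OF s _ memS[OF xy(1) s] memS[OF xy(2)]] by fastforce
      qed
    qed
    then show "x \<otimes>\<^bsub>?R\<^esub> y \<in> ?S" by simp
  qed
  ultimately have "subring ?S ?R" by (simp add: subring_def)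
  moreover have "homog x g \<in> ?S \<or> inv\<^bsub>?R\<^esub> (homog x g) \<in> ?S" if "g \<in> G" "x \<noteq> 0" for g x
    using tot[OF that] mem[OF that(1)] mem[OF G(2)[OF that(1)]] inv_homog[OF that(2) G(2)[OF that(1)]]
    by simp
  ultimately show "graded_extension G \<sigma> V A"
    using A0 by (simp add: graded_extension_def graded_total_valuation_ring_def)
qed

lemma multiples_group:
  "0 \<in> multiples k" "g \<in> multiples k \<Longrightarrow> - g \<in> multiples k"
  "g \<in> multiples k \<Longrightarrow> h \<in> multiples k \<Longrightarrow> g + h \<in> multiples k"
proof -
  have *: "of_int j * k \<in> multiples k" for j unfolding multiples_def by (rule rangeI)
  show "0 \<in> multiples k" using *[of 0] by simp
  show "- g \<in> multiples k" if "g \<in> multiples k"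
  proof -
    from that obtain i where "g = of_int i * k" by (auto simp: multiples_def)
    then show ?thesis using *[of "- i"] by simp
  qed
  show "g + h \<in> multiples k" if "g \<in> multiples k" "h \<in> multiples k"
  proof -
    from that obtain i j where "g = of_int i * k" "h = of_int j * k" by (auto simp: multiples_def)
    then show ?thesis using *[of "i + j"] by (simp add: distrib_right)
  qed
qed

lemma graded_extension_UNIV: "graded_extension UNIV \<sigma> V A \<longleftrightarrow> graded_family UNIV V A"
  and graded_extension_multiples: "graded_extension (multiples k) \<sigma> V A \<longleftrightarrow> graded_family (multiples k) V A"
  by (rule graded_extension_iff; simp add: multiples_group)+

lemma graded_family_subset: "graded_family UNIV V A \<Longrightarrow> graded_family G V A"
  unfolding graded_family_def by (elim conjE, intro conjI; simp)

end

section \<open>Components of a graded extension\<close>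

locale graded_valuation = principal_valuation \<sigma> W b + V: valuation V
  for \<sigma> :: "rat \<Rightarrow> 'a::division_ring \<Rightarrow> 'a" and W :: "'a set" and b :: 'a and V :: "'a set" +
  fixes A :: "rat \<Rightarrow> 'a set"
  assumes family: "graded_family UNIV V A"
    and union: "W = union_ring A"
    and top_order: "\<exists>t. left_order (A t) = W"
begin

lemma A_additive: "additive_subgrp (A s)"
  and A_mult: "x \<in> A s \<Longrightarrow> y \<in> A t \<Longrightarrow> x * \<sigma> s y \<in> A (s + t)"
  and A_0: "A 0 = V"
  and A_total: "x \<notin> A s \<Longrightarrow> x \<noteq> 0 \<Longrightarrow> \<sigma> (- s) (inverse x) \<in> A (- s)"
  using family by (auto simp: graded_family_def)

lemma A_zero [simp]: "0 \<in> A s"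
  using A_additive by (rule additive_subgrp_zero)

lemma A_dual:
  assumes "x \<notin> A s" shows "\<sigma> (- s) (inverse x) \<in> A (- s)"
  using A_total[OF assms] assms by (metis A_zero)

lemma left_order_subset: "left_order (A s) \<subseteq> W"
  using union by (auto simp: union_ring_def)

lemma V_left: "v \<in> V \<Longrightarrow> x \<in> A s \<Longrightarrow> v * x \<in> A s"
  using A_mult[of v 0 x s] A_0 by simp

lemma V_subset_W: "V \<subseteq> W"
  using V_left left_order_subset[of 0] by (auto simp: mem_left_order)

text \<open>An element outside \<open>A s\<close> has its inverse in degree \<open>- s\<close>, and the product of the degrees \<open>s\<close> and
\<open>- s\<close> lies in \<open>V\<close>; so it bounds the whole component.\<close>

lemma A_ratio:
  assumes "x \<in> A s" "y \<notin> A s" shows "x * inverse y \<in> V"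
  using A_mult[OF assms(1) A_dual[OF assms(2)]] A_0 by simp

lemma A_ratio_W: "x \<in> A s \<Longrightarrow> y \<notin> A s \<Longrightarrow> x \<in> r_mult W y"
  using A_ratio[of x s y] V_subset_W A_zero[of s] by (subst r_mult_iff) auto

text \<open>The left order in degree \<open>- s\<close> is the right order in degree \<open>s\<close>, transported by \<open>\<sigma> s\<close>. If
the two components are not exactly dual to each other, some \<open>y\<close> and its inverse are both homogeneous
elements of the extension; then both orders equal \<open>V\<close> up to this transport.\<close>

lemma left_order_uminus: "x \<in> left_order (A (- s)) \<longleftrightarrow> (\<forall>y\<in>A s. y * \<sigma> s x \<in> A s)"
proof
  assume x: "x \<in> left_order (A (- s))"
  show "\<forall>y\<in>A s. y * \<sigma> s x \<in> A s"
  proof (rule ballI, rule ccontr)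
    fix y assume y: "y \<in> A s" "y * \<sigma> s x \<notin> A s"
    have nz: "y \<noteq> 0" "x \<noteq> 0" using y(2) by auto
    have "\<sigma> (- s) (inverse (y * \<sigma> s x)) = inverse x * \<sigma> (- s) (inverse y)"
      using nz by (simp add: inverse_mult)
    then have "inverse x * \<sigma> (- s) (inverse y) \<in> A (- s)" using A_dual[OF y(2)] by simp
    then have "x * (inverse x * \<sigma> (- s) (inverse y)) \<in> A (- s)" using x by (simp only: mem_left_order)
    then have y': "\<sigma> (- s) (inverse y) \<in> A (- s)" using nz by simp
    then have "x * \<sigma> (- s) (inverse y) \<in> A (- s)" using x by (simp only: mem_left_order)
    from A_mult[OF this y(1)] have "x \<in> V" using nz A_0 by (simp add: mult.assoc)
    then have "y * \<sigma> s x \<in> A s" using A_mult[OF y(1), of x 0] A_0 by simp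
    then show False using y(2) by simp
  qed
next
  assume R: "\<forall>y\<in>A s. y * \<sigma> s x \<in> A s"
  show "x \<in> left_order (A (- s))" unfolding mem_left_order
  proof (rule ballI, rule ccontr)
    fix y assume y: "y \<in> A (- s)" "x * y \<notin> A (- s)"
    have nz: "y \<noteq> 0" "x \<noteq> 0" using y(2) by auto
    have "\<sigma> s (inverse (x * y)) \<in> A s" using A_dual[OF y(2)] by simp
    then have "\<sigma> s (inverse (x * y)) * \<sigma> s x \<in> A s" using R by blast
    then have "\<sigma> s (inverse y) \<in> A s" using nz by (simp add: inverse_mult mult.assoc)
    then have "\<sigma> s (inverse y) * \<sigma> s x \<in> A s" using R by blast
    from A_mult[OF y(1) this] have "x \<in> V" using nz A_0 by simp
    then show False using V_left y by blast
  qed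
qed

lemma A_dual_nonunits:
  assumes "A t = r_mult W a" "a \<noteq> 0" "j \<in> nonunits W"
  shows "\<sigma> (- t) (inverse a * j) \<in> A (- t)"
proof (cases "j = 0")
  case False
  then have "inverse j * a \<notin> A t" using assms by (simp add: r_mult_iff mult.assoc nonunits_def)
  from A_dual[OF this] show ?thesis using False assms(2) by (simp add: inverse_mult)
qed simp

text \<open>Since \<open>b\<close> is not in the left order, some \<open>m\<close> in the component has \<open>b * m\<close> outside it. As \<open>inverse b\<close>
generates the radical, a component that is a left \<open>W\<close>-module and contains more than \<open>r_mult W m\<close> would
contain \<open>b * m\<close>.\<close>

lemma top_principal:
  assumes "left_order (A t) = W" obtains a where "a \<noteq> 0" "A t = r_mult W a"
proof -
  have "b \<notin> left_order (A t)" using assms by simp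
  then obtain m where m: "m \<in> A t" "b * m \<notin> A t" by (auto simp: mem_left_order)
  then have nz: "m \<noteq> 0" by auto
  have W: "w * x \<in> A t" if "w \<in> W" "x \<in> A t" for w x using that assms by (auto simp: mem_left_order)
  have "A t = r_mult W m"
  proof
    show "r_mult W m \<subseteq> A t" using W m by (auto simp: r_mult_def)
    show "A t \<subseteq> r_mult W m"
    proof
      fix x assume x: "x \<in> A t"
      show "x \<in> r_mult W m"
      proof (rule ccontr)
        assume "x \<notin> r_mult W m"
        then have notin: "x * inverse m \<notin> W" using nz by (simp add: r_mult_iff)
        then have xnz: "x \<noteq> 0" by auto
        have "m * inverse x \<in> nonunits W" using nonunitsI[OF notin] nz xnz by (simp add: inverse_mult)
        then have "b * (m * inverse x) \<in> W" by (simp add: jac_iff_left)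
        then have "b * (m * inverse x) * x \<in> A t" using W x by blast
        then show False using m xnz by (simp add: mult.assoc)
      qed
    qed
  qed
  then show ?thesis using that nz by blast
qed

text \<open>Write \<open>\<tau> x = a * \<sigma> t x * inverse a\<close> for a generator \<open>a\<close> of \<open>A t\<close>. The component of degree \<open>- t\<close>
has, up to transport, the left order \<open>{x. \<tau> x \<in> W}\<close>, which is contained in \<open>W\<close>. If it were smaller
than \<open>W\<close>, then \<open>A (t + t)\<close>, which contains \<open>\<tau> W * a * \<sigma> t a\<close>, would be equal to this set and its left
order would not be contained in \<open>W\<close>. So \<open>\<tau>\<close> maps \<open>W\<close> onto itself.\<close>

lemma top_normalizing:
  assumes t: "left_order (A t) = W"
  obtains a where "normalizing t a" "A t = r_mult W a" "left_order (A (- t)) = W"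
proof -
  obtain a where a: "a \<noteq> 0" "A t = r_mult W a" using top_principal[OF t] .
  have right: "x \<in> left_order (A (- t)) \<longleftrightarrow> a * \<sigma> t x * inverse a \<in> W" for x
  proof -
    have "x \<in> left_order (A (- t)) \<longleftrightarrow> (\<forall>w\<in>W. w * a * \<sigma> t x \<in> r_mult W a)"
      unfolding left_order_uminus a(2) by (simp add: r_mult_def)
    also have "\<dots> \<longleftrightarrow> (\<forall>w\<in>W. w * (a * \<sigma> t x * inverse a) \<in> W)"
      using a by (simp add: r_mult_iff mult.assoc)
    also have "\<dots> \<longleftrightarrow> a * \<sigma> t x * inverse a \<in> W" using mult by (metis mult_1 one)
    finally show ?thesis .
  qed
  have sub: "a * \<sigma> t x * inverse a \<in> W" if x: "x \<in> W" for x
  proof (rule ccontr)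
    assume notin: "a * \<sigma> t x * inverse a \<notin> W"
    define c where "c = a * \<sigma> t a"
    have c: "c \<noteq> 0" using a by (simp add: c_def)
    have low: "a * \<sigma> t w * inverse a * c \<in> A (t + t)" if "w \<in> W" for w
    proof -
      have "a \<in> A t" "w * a \<in> A t" using a that r_mult_self by (auto simp: r_mult_def)
      from A_mult[OF this] show ?thesis using a by (simp add: c_def mult.assoc)
    qed
    have up: "\<exists>w\<in>W. y = a * \<sigma> t w * inverse a * c" if y: "y \<in> A (t + t)" for y
    proof -
      define w where "w = \<sigma> (- t) (inverse a * (y * inverse c) * a)"
      have y_eq: "y = a * \<sigma> t w * inverse a * c" unfolding w_def sigma_cancel using a c by (simp add: mult.assoc)
      moreover have "w \<in> W"
      proof (rule ccontr)
        assume w: "w \<notin> W"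
        then have wnz: "w \<noteq> 0" by auto
        define j where "j = inverse w * x"
        have j: "j \<in> nonunits W" using nonunitsI[OF w] x nonunits_mult_right by (simp add: j_def)
        from A_mult[OF y A_dual_nonunits[OF a(2,1) j]]
        have "y * (inverse (\<sigma> t a) * \<sigma> t j) \<in> A t" by (simp add: sigma_sigma)
        moreover have "y * (inverse (\<sigma> t a) * \<sigma> t j) = a * \<sigma> t x"
          unfolding y_eq c_def j_def using a wnz by (simp add: mult.assoc)
        ultimately show False using notin a by (simp add: r_mult_iff)
      qed
      ultimately show ?thesis by blast
    qed
    have "a * \<sigma> t x * inverse a \<in> left_order (A (t + t))" unfolding mem_left_order
    proof
      fix y assume "y \<in> A (t + t)"
      then obtain w where w: "w \<in> W" "y = a * \<sigma> t w * inverse a * c" using up by blast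
      have "a * \<sigma> t x * inverse a * y = a * \<sigma> t (x * w) * inverse a * c"
        using a w by (simp add: mult.assoc)
      then show "a * \<sigma> t x * inverse a * y \<in> A (t + t)" using low[OF mult[OF x w(1)]] by simp
    qed
    then show False using left_order_subset notin by blast
  qed
  have eq: "left_order (A (- t)) = W"
    using sub right left_order_subset by blast
  moreover have "normalizing t a" using right a eq by (simp add: normalizing_def)
  ultimately show ?thesis using that a by blast
qed

text \<open>If \<open>A s\<close> is not a \<open>W\<close>-module, any \<open>y = w * x\<close> outside \<open>A s\<close> with \<open>x \<in> A s\<close> generates the \<open>W\<close>-module that
\<open>A s\<close> spans. That \<open>y\<close> normalizes \<open>W\<close> is seen by shifting the degree by some \<open>t\<close> with left order \<open>W\<close>:
the component of degree \<open>t + s\<close> is generated over \<open>W\<close> by \<open>a * \<sigma> t y\<close>, so the preceding lemma applies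
to it, and normalizing elements form a group.\<close>

lemma generator:
  obtains y where "normalizing s y" "A s \<subseteq> r_mult W y" "\<exists>w\<in>W. \<exists>x\<in>A s. y = w * x"
    "left_order (A s) = W \<longrightarrow> A s = r_mult W y"
proof (cases "left_order (A s) = W")
  case True
  obtain a where a: "normalizing s a" "A s = r_mult W a" "left_order (A (- s)) = W"
    using top_normalizing[OF True] .
  have "\<exists>w\<in>W. \<exists>x\<in>A s. a = w * x"
    by (rule bexI[OF _ one], rule bexI[of _ a]) (simp_all add: a(2) r_mult_self)
  from that[OF a(1) _ this] show ?thesis by (simp add: a(2))
next
  case False
  obtain t where t: "left_order (A t) = W" using top_order by blast
  obtain a where a: "normalizing t a" "A t = r_mult W a" "left_order (A (- t)) = W"
    using top_normalizing[OF t] .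
  have anz: "a \<noteq> 0" using a by (simp add: normalizing_def)
  obtain w x where wx: "w \<in> W" "x \<in> A s" "w * x \<notin> A s"
  proof -
    obtain w where "w \<in> W" "w \<notin> left_order (A s)" using False left_order_subset[of s] by auto
    then show ?thesis using that by (auto simp: mem_left_order)
  qed
  define y where "y = w * x"
  have ynz: "y \<noteq> 0" using wx A_zero[of s] by (auto simp: y_def)
  have As: "A s \<subseteq> r_mult W y" using A_ratio_W wx by (auto simp: y_def)
  define c where "c = a * \<sigma> t y"
  have cnz: "c \<noteq> 0" using anz ynz by (simp add: c_def)
  have "A (t + s) = r_mult W c"
  proof
    show "r_mult W c \<subseteq> A (t + s)"
    proof
      fix z assume "z \<in> r_mult W c"
      then obtain v where v: "v \<in> W" "z = v * c" by (auto simp: r_mult_def)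
      have "v * (a * \<sigma> t w * inverse a) \<in> W" using v wx normalizing_iff[OF a(1)] mult by blast
      then have "v * (a * \<sigma> t w * inverse a) * a \<in> A t" using a(2) by (auto simp: r_mult_def)
      from A_mult[OF this wx(2)] show "z \<in> A (t + s)"
        using anz v by (simp add: c_def y_def mult.assoc)
    qed
    show "A (t + s) \<subseteq> r_mult W c"
    proof (rule subsetI, rule ccontr)
      fix z assume z: "z \<in> A (t + s)" "z \<notin> r_mult W c"
      then have d: "z * inverse c \<notin> W" using cnz by (simp add: r_mult_iff)
      then have znz: "z \<noteq> 0" by auto
      have "c * inverse z \<in> nonunits W" using nonunitsI[OF d] znz cnz by (simp add: inverse_mult)
      from A_mult[OF A_dual_nonunits[OF a(2) anz this] z(1)]
      have "\<sigma> (- t) (inverse a * (c * inverse z)) * \<sigma> (- t) z \<in> A s" by simp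
      moreover have "\<sigma> (- t) (inverse a * (c * inverse z)) * \<sigma> (- t) z = y"
        unfolding sigma_mult[symmetric] using znz anz by (simp add: c_def mult.assoc del: sigma_mult) 
      ultimately show False using wx by (simp add: y_def)
    qed
  qed
  note ts = this
  then have "left_order (A (t + s)) = W" using left_order_r_mult cnz by simp
  then obtain d where d: "normalizing (t + s) d" "A (t + s) = r_mult W d" by (rule top_normalizing)
  have "normalizing (t + s) c" by (rule normalizing_cong[OF d(1)]) (simp flip: ts d(2))
  then have "normalizing s y" using normalizing_quotient[OF a(1)] by (simp add: c_def)
  moreover have "\<exists>w\<in>W. \<exists>x\<in>A s. y = w * x"
    unfolding y_def by (rule bexI[OF _ wx(1)], rule bexI[OF _ wx(2)]) simp
  ultimately show ?thesis using that[OF _ As] False by simp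
qed

abbreviation \<beta> where "\<beta> \<equiv> chosen_beta \<sigma> A"

lemma beta:
  shows beta_normalizing: "normalizing s (\<beta> s)"
    and beta_prod: "set_prod W (A s) = r_mult W (\<beta> s)"
    and A_subset: "A s \<subseteq> r_mult W (\<beta> s)"
    and beta_mem: "\<exists>w\<in>W. \<exists>x\<in>A s. \<beta> s = w * x"
    and A_full: "A s = r_mult W (\<beta> s) \<longleftrightarrow> left_order (A s) = W"
proof -
  obtain y where y: "normalizing s y" "A s \<subseteq> r_mult W y" "\<exists>w\<in>W. \<exists>x\<in>A s. y = w * x"
    "left_order (A s) = W \<longrightarrow> A s = r_mult W y" by (rule generator[of s])
  obtain w0 x0 where wx: "w0 \<in> W" "x0 \<in> A s" "y = w0 * x0" using y(3) by blast
  have ynz: "y \<noteq> 0" using y by (simp add: normalizing_def)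
  have prod: "set_prod W (A s) = r_mult W y"
  proof (rule set_prod_eqI)
    show "additive_subgrp (r_mult W y)" by (intro additive_subgrp_r_mult add_sub)
    show "w * x \<in> r_mult W y" if "w \<in> W" "x \<in> A s" for w x
      using W_r_mult[OF that(1)] subsetD[OF y(2) that(2)] by blast
    fix z assume "z \<in> r_mult W y"
    then obtain v where "v \<in> W" "z = v * y" by (auto simp: r_mult_def)
    then have "v * w0 \<in> W" "z = v * w0 * x0" using wx mult by (auto simp: mult.assoc)
    then show "\<exists>x\<in>W. \<exists>y\<in>A s. z = x * y" using wx(2) by (metis (no_types))
  qed
  have "set_prod W (A s) = r_mult W (\<beta> s) \<and> r_mult W (\<beta> s) = l_mult (\<beta> s) (\<sigma> s ` W)"
    unfolding chosen_beta_def Let_def union[symmetric]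
    by (rule someI[of _ y]) (use prod y normalizing_sets ynz in auto)
  then show "set_prod W (A s) = r_mult W (\<beta> s)" by blast
  then have eq: "r_mult W (\<beta> s) = r_mult W y" using prod by simp
  then show "normalizing s (\<beta> s)" using normalizing_cong y by blast
  then have bnz: "\<beta> s \<noteq> 0" by (simp add: normalizing_def)
  show "A s \<subseteq> r_mult W (\<beta> s)" using y eq by simp
  have "\<beta> s \<in> r_mult W y" using eq r_mult_self by metis
  then obtain v where "v \<in> W" "\<beta> s = v * y" by (auto simp: r_mult_def)
  then have "v * w0 \<in> W" "\<beta> s = v * w0 * x0" using wx mult by (auto simp: mult.assoc)
  then show "\<exists>w\<in>W. \<exists>x\<in>A s. \<beta> s = w * x" using wx(2) by (metis (no_types))
  show "A s = r_mult W (\<beta> s) \<longleftrightarrow> left_order (A s) = W"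
    using y(4) eq left_order_r_mult[OF bnz] by auto
qed

lemma beta_nz [simp]: "\<beta> s \<noteq> 0"
  using beta_normalizing by (rule normalizing_nz)

end

section \<open>The cocycle of a graded extension\<close>

context graded_valuation
begin

lemma beta_prod_upper: "\<beta> s * \<sigma> s (\<beta> t) \<in> r_mult W (\<beta> (s + t))"
proof -
  obtain w x where wx: "w \<in> W" "x \<in> A s" "\<beta> s = w * x" using beta_mem by blast
  obtain w' x' where wx': "w' \<in> W" "x' \<in> A t" "\<beta> t = w' * x'" using beta_mem by blast
  have u: "\<beta> s * \<sigma> s w' * inverse (\<beta> s) \<in> W"
    using normalizing_iff[OF beta_normalizing] wx' by blast
  have "\<beta> s * \<sigma> s (\<beta> t) = (\<beta> s * \<sigma> s w' * inverse (\<beta> s)) * (\<beta> s * \<sigma> s x')"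
    unfolding wx'(3) by (simp add: mult.assoc)
  moreover have "\<beta> s * \<sigma> s x' = w * (x * \<sigma> s x')"
    unfolding wx(3) by (simp add: mult.assoc)
  moreover have "x * \<sigma> s x' \<in> r_mult W (\<beta> (s + t))" using A_mult[OF wx(2) wx'(2)] A_subset by auto
  ultimately show ?thesis using W_r_mult[OF u W_r_mult[OF wx(1)]] by simp
qed

text \<open>The products over opposite degrees are at least as large as the radical, because \<open>\<sigma> (- s) (inverse y)\<close>
lies in \<open>A (- s)\<close> for every \<open>y\<close> outside \<open>A s\<close>; and outside \<open>A s\<close> there are elements arbitrarily close to
the generator.\<close>

lemma beta_prod_uminus:
  shows "inverse b \<in> r_mult W (\<beta> s * \<sigma> s (\<beta> (- s)))"
    and "left_order (A s) \<noteq> W \<Longrightarrow> 1 \<in> r_mult W (\<beta> s * \<sigma> s (\<beta> (- s)))"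
proof -
  have *: "\<beta> s * \<sigma> s x \<in> r_mult W (\<beta> s * \<sigma> s (\<beta> (- s)))" if "x \<in> A (- s)" for x
    unfolding normalizing_mult_mem[OF beta_normalizing beta_nz] using A_subset that by (rule subsetD)
  show 1: "1 \<in> r_mult W (\<beta> s * \<sigma> s (\<beta> (- s)))" if "left_order (A s) \<noteq> W"
  proof -
    obtain y where y: "y \<in> r_mult W (\<beta> s)" "y \<notin> A s"
    proof -
      have "A s \<noteq> r_mult W (\<beta> s)" using \<open>left_order (A s) \<noteq> W\<close> unfolding A_full .
      then have "\<exists>y. y \<in> r_mult W (\<beta> s) \<and> y \<notin> A s" using A_subset[of s] by blast
      then show ?thesis using that by blast
    qed
    then obtain w where w: "w \<in> W" "y = w * \<beta> s" by (auto simp: r_mult_def)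
    have nz: "y \<noteq> 0" using y(2) by auto
    from W_r_mult[OF w(1) *[OF A_dual[OF y(2)]]] show ?thesis
      using nz w(2) by (simp flip: mult.assoc)
  qed
  show "inverse b \<in> r_mult W (\<beta> s * \<sigma> s (\<beta> (- s)))"
  proof (cases "left_order (A s) = W")
    case True
    then have "A s = r_mult W (\<beta> s)" by (simp add: A_full)
    moreover have "inverse b \<in> nonunits W" by (simp add: jac_iff)
    ultimately show ?thesis using *[OF A_dual_nonunits[of s "\<beta> s" "inverse b"]] by simp
  next
    case False
    have "inverse b \<in> W" using jac_iff[of "inverse b"] by (simp add: nonunits_def)
    from W_r_mult[OF this 1[OF False]] show ?thesis by simp
  qed
qed

text \<open>Multiplying from degree \<open>s\<close> to degree \<open>s + t\<close> loses at most one power of \<open>b\<close>, because going back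
through degree \<open>- s\<close> already loses at most one.\<close>

lemma beta_prod_lower: "inverse b * \<beta> (s + t) \<in> r_mult W (\<beta> s * \<sigma> s (\<beta> t))"
proof -
  obtain w where w: "w \<in> W" "inverse b = w * (\<beta> s * \<sigma> s (\<beta> (- s)))"
    using beta_prod_uminus(1)[of s] by (auto simp: r_mult_def)
  have "\<beta> (- s) * \<sigma> (- s) (\<beta> (s + t)) \<in> r_mult W (\<beta> t)"
    using beta_prod_upper[of "- s" "s + t"] by simp
  then have "\<beta> s * \<sigma> s (\<beta> (- s) * \<sigma> (- s) (\<beta> (s + t))) \<in> r_mult W (\<beta> s * \<sigma> s (\<beta> t))"
    by (simp only: normalizing_mult_mem[OF beta_normalizing beta_nz])
  from W_r_mult[OF w(1) this] show ?thesis unfolding w(2) by (simp add: mult.assoc)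
qed

text \<open>The cocycle of the central extension of the rationals by the powers of \<open>b\<close> that the classes of the
\<open>\<beta> s\<close> generate.\<close>

definition \<epsilon> :: "rat \<Rightarrow> rat \<Rightarrow> int" where
  "\<epsilon> s t = (if r_mult W (\<beta> s * \<sigma> s (\<beta> t)) = r_mult W (\<beta> (s + t)) then 0 else 1)"

lemma eps: "r_mult W (\<beta> s * \<sigma> s (\<beta> t)) = r_mult W (b powi (- \<epsilon> s t) * \<beta> (s + t))"
proof -
  define d where "d = \<beta> s * \<sigma> s (\<beta> t) * inverse (\<beta> (s + t))"
  have d: "\<beta> s * \<sigma> s (\<beta> t) = d * \<beta> (s + t)" "d \<noteq> 0" by (simp_all add: d_def mult.assoc)
  have "d \<in> W" using beta_prod_upper[of s t] by (simp add: r_mult_iff d_def)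
  moreover have "inverse b * inverse d \<in> W"
    using beta_prod_lower[of s t] by (simp add: r_mult_iff d_def inverse_mult mult.assoc)
  ultimately consider "r_mult W d = r_mult W 1" | "r_mult W d = r_mult W (inverse b)"
    using r_mult_split[OF d(2)] by auto
  then show ?thesis
  proof cases
    case 1
    from r_mult_cong_right[OF this, of "\<beta> (s + t)"] show ?thesis by (simp add: \<epsilon>_def d(1))
  next
    case 2
    from r_mult_cong_right[OF this, of "\<beta> (s + t)"] show ?thesis
      by (simp add: \<epsilon>_def d(1) power_int_minus)
  qed
qed

lemma eps_bounds: "0 \<le> \<epsilon> s t" "\<epsilon> s t \<le> 1"
  by (simp_all add: \<epsilon>_def)

lemma beta_0: "r_mult W (\<beta> 0) = W"
proof -
  have "set_prod W V = W"
  proof (rule set_prod_eqI)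
    show "\<exists>x\<in>W. \<exists>y\<in>V. z = x * y" if "z \<in> W" for z
      by (rule bexI[OF _ that], rule bexI[OF _ V.one]) simp
  qed (use V_subset_W mult add_sub in auto)
  then show ?thesis using beta_prod[of 0] A_0 by simp
qed

sublocale eps: rational_cocycle \<epsilon>
proof
  fix r s t
  let ?x = "\<beta> r * \<sigma> r (\<beta> s) * \<sigma> (r + s) (\<beta> t)"
  have "r_mult W ?x = r_mult W (b powi (- \<epsilon> r s) * \<beta> (r + s) * \<sigma> (r + s) (\<beta> t))"
    by (rule r_mult_cong_right[OF eps])
  also have "\<dots> = r_mult W (b powi (- \<epsilon> r s) * (b powi (- \<epsilon> (r + s) t) * \<beta> (r + s + t)))"
    unfolding mult.assoc by (rule r_mult_powi_cong[OF eps])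
  also have "\<dots> = r_mult W (b powi (- \<epsilon> r s - \<epsilon> (r + s) t) * \<beta> (r + s + t))"
    using powi_b_add[of "- \<epsilon> r s" "- \<epsilon> (r + s) t"] by (simp add: mult.assoc)
  finally have 1: "r_mult W ?x = r_mult W (b powi (- \<epsilon> r s - \<epsilon> (r + s) t) * \<beta> (r + s + t))" .
  have "?x = \<beta> r * \<sigma> r (\<beta> s * \<sigma> s (\<beta> t))" by (simp add: sigma_sigma mult.assoc)
  also have "r_mult W \<dots> = r_mult W (b powi (- \<epsilon> s t) * (\<beta> r * \<sigma> r (\<beta> (s + t))))"
    by (rule b_shift[OF beta_normalizing eps])
  also have "\<dots> = r_mult W (b powi (- \<epsilon> s t) * (b powi (- \<epsilon> r (s + t)) * \<beta> (r + (s + t))))"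
    by (rule r_mult_powi_cong[OF eps])
  also have "\<dots> = r_mult W (b powi (- \<epsilon> s t - \<epsilon> r (s + t)) * \<beta> (r + s + t))"
    using powi_b_add[of "- \<epsilon> s t" "- \<epsilon> r (s + t)"] by (simp add: mult.assoc add.assoc)
  finally show "\<epsilon> r s + \<epsilon> (r + s) t = \<epsilon> s t + \<epsilon> r (s + t)"
    unfolding 1 by (simp add: powi_b_eq_iff)
next
  fix s
  have "r_mult W (\<beta> 0) = r_mult W 1" using beta_0 by simp
  from r_mult_cong_right[OF this, of "\<beta> s"] show "\<epsilon> 0 s = 0" by (simp add: \<epsilon>_def)
  have "r_mult W (\<beta> 0) = r_mult W 1" using beta_0 by simp
  from r_mult_cong_left[OF beta_normalizing this, of s] show "\<epsilon> s 0 = 0" by (simp add: \<epsilon>_def)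
qed (simp add: eps_bounds)

lemma eps_uminus_eq_0_iff: "\<epsilon> s (- s) = 0 \<longleftrightarrow> r_mult W (\<beta> s * \<sigma> s (\<beta> (- s))) = W"
  by (simp add: \<epsilon>_def beta_0)

lemma eps_not_full: "left_order (A s) \<noteq> W \<Longrightarrow> \<epsilon> s (- s) = 0"
proof -
  assume "left_order (A s) \<noteq> W"
  then have 1: "1 \<in> r_mult W (\<beta> s * \<sigma> s (\<beta> (- s)))" by (rule beta_prod_uminus)
  have 2: "\<beta> s * \<sigma> s (\<beta> (- s)) \<in> r_mult W 1" using beta_prod_upper[of s "- s"] beta_0 by simp
  have "r_mult W 1 = r_mult W (\<beta> s * \<sigma> s (\<beta> (- s)))"
    using r_mult_mem_subset[OF 1] r_mult_mem_subset[OF 2] by (intro antisym) simp_all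
  then show ?thesis by (simp add: eps_uminus_eq_0_iff)
qed

text \<open>If \<open>A s\<close> and \<open>A (- s)\<close> are both \<open>W\<close>-modules, their product is a \<open>W\<close>-module inside \<open>V\<close>. For \<open>W \<noteq> V\<close>
it can therefore not be \<open>W\<close>.\<close>

lemma eps_full:
  assumes "left_order (A s) = W" "W \<noteq> V" shows "\<epsilon> s (- s) = 1"
proof (rule ccontr)
  assume "\<epsilon> s (- s) \<noteq> 1"
  then have "\<epsilon> s (- s) = 0" using eps_bounds[of s "- s"] by simp
  then have eq: "r_mult W (\<beta> s * \<sigma> s (\<beta> (- s))) = W" by (simp add: eps_uminus_eq_0_iff)
  have "left_order (A (- s)) = W" by (rule top_normalizing[OF assms(1)])
  then have full: "A s = r_mult W (\<beta> s)" "A (- s) = r_mult W (\<beta> (- s))"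
    using assms(1) unfolding A_full by auto
  have "w \<in> V" if "w \<in> W" for w
  proof -
    from that eq have "w \<in> r_mult W (\<beta> s * \<sigma> s (\<beta> (- s)))" by blast
    then obtain v where v: "v \<in> W" "w = v * (\<beta> s * \<sigma> s (\<beta> (- s)))" by (auto simp: r_mult_def)
    have "v * \<beta> s \<in> A s" "\<beta> (- s) \<in> A (- s)" unfolding full using v r_mult_self by (auto simp: r_mult_def)
    from A_mult[OF this] show ?thesis using v A_0 by (simp add: mult.assoc)
  qed
  then show False using assms V_subset_W by blast
qed

lemma all_full: "W = V \<Longrightarrow> left_order (A s) = W"
  using V_left left_order_subset[of s] by (auto simp: mem_left_order)

text \<open>For \<open>W \<noteq> V\<close> the degree with left order \<open>W\<close> serves. For \<open>W = V\<close> all components are \<open>W\<close>-modules, so if no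
degree served, all products of components would be exact, against Type (II).\<close>

lemma eps_nonzero:
  assumes "type_II (multiples r) \<sigma> V A" obtains s where "\<epsilon> s (- s) \<noteq> 0"
proof (rule ccontr)
  assume none: "\<not> thesis"
  then have 0: "\<epsilon> s (- s) = 0" for s using that by blast
  obtain t where "left_order (A t) = W" using top_order by blast
  then have WV: "W = V" using eps_full[of t] 0[of t] by fastforce
  have full: "A s = r_mult W (\<beta> s)" for s unfolding A_full by (rule all_full[OF WV])
  have "set_prod (A g) (\<sigma> g ` A h) = A (g + h)" for g h
  proof -
    have "\<epsilon> g h = 0" by (rule eps.vanish_left[OF 0])
    then have "r_mult W (\<beta> g * \<sigma> g (\<beta> h)) = r_mult W (\<beta> (g + h))" using eps[of g h] by simp
    then show ?thesis
      unfolding full[of g] full[of h] full[of "g + h"] set_prod_normalizing[OF beta_normalizing] .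
  qed
  moreover have "set_prod (A (- g)) (\<sigma> (- g) ` A (- h)) = A (- g - h)" for g h
    using calculation[of "- g" "- h"] by simp
  ultimately show False using assms by (simp add: type_II_def)
qed

text \<open>Some \<open>1 / l\<close> is not an invertible degree; over its multiples the extension is of Type (e). Hence
the choice made in the definition of the suprema is a genuine one.\<close>

lemma chosen_l_pos:
  assumes "\<epsilon> s (- s) \<noteq> 0" shows "0 < chosen_l \<sigma> A"
proof -
  obtain l :: nat where l: "0 < l" "\<epsilon> (1 / of_nat l) (- (1 / of_nat l)) \<noteq> 0"
  proof -
    have "\<not> (\<forall>l::nat. 0 < l \<longrightarrow> \<epsilon> (1 / of_nat l) (- (1 / of_nat l)) = 0)"
      using eps.vanish_all[of s] assms by metis
    then show ?thesis using that by blast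
  qed
  define g :: rat where "g = 1 / of_nat l"
  have e: "\<epsilon> g (- g) = 1" using l eps_bounds[of g "- g"] by (simp add: g_def)
  then have top: "left_order (A g) = W" using eps_not_full[of g] by (metis zero_neq_one)
  have "left_order (A (- g)) = W" by (rule top_normalizing[OF top])
  then have full: "A g = r_mult W (\<beta> g)" "A (- g) = r_mult W (\<beta> (- g))"
    using top unfolding A_full by auto
  have "r_mult W (\<beta> (- g) * \<sigma> (- g) (\<beta> g)) = r_mult W (inverse b * \<beta> 0)"
    using eps[of "- g" g] e eps.swap_neg[of g] by (simp add: power_int_minus)
  also have "\<dots> = r_mult W (inverse b * 1)"
    using r_mult_powi_cong[of "\<beta> 0" 1 "- 1"] beta_0 by (simp add: power_int_minus)
  finally have "r_mult W (\<beta> (- g) * \<sigma> (- g) (\<beta> g) * \<sigma> (- g) (inverse (\<beta> g)))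
      = r_mult W (inverse b * 1 * \<sigma> (- g) (inverse (\<beta> g)))"
    by (rule r_mult_cong_right)
  then have neg: "A (- g) = r_mult (jacobson W) (\<sigma> (- g) (inverse (\<beta> g)))"
    unfolding full jac r_mult_r_mult by (simp add: mult.assoc)
  have "type_e_cyclic g \<sigma> (A 0) A"
    unfolding type_e_cyclic_def Let_def top
  proof (intro conjI exI)
    show "graded_extension (multiples g) \<sigma> (A 0) A"
      unfolding graded_extension_multiples A_0 by (rule graded_family_subset[OF family])
    show "A g = l_mult (\<beta> g) (\<sigma> g ` W)"
      using full beta_normalizing[of g] normalizing_sets[OF beta_nz] by simp
  qed (use full neg jac in simp_all)
  then have "\<exists>l. 0 < l \<and> type_e_cyclic (1 / of_nat l) \<sigma> (A 0) A \<and>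
     left_order (A (1 / of_nat l)) = union_ring A"
    using l top union by (intro exI[of _ l]) (simp add: g_def)
  then show ?thesis unfolding chosen_l_def by (rule someI2_ex) blast
qed

end

section \<open>Bounded suprema split the cocycle\<close>

lemma integer_SUP_bounded:
  fixes g :: "nat \<Rightarrow> int"
  assumes "(SUP n\<in>{1..}. ereal (of_int (g n))) < \<infinity>"
  obtains C :: int where "\<And>n. 1 \<le> n \<Longrightarrow> g n \<le> C"
proof -
  have "(SUP n\<in>{1..}. ereal (of_int (g n))) \<noteq> \<infinity>" using assms by simp
  from iffD1[OF less_PInf_Ex_of_nat this]
  obtain k :: nat where k: "(SUP n\<in>{1..}. ereal (of_int (g n))) < ereal (real k)" ..
  have "g n \<le> int k" if "1 \<le> n" for n
  proof -
    have "ereal (of_int (g n)) \<le> (SUP n\<in>{1..}. ereal (of_int (g n)))"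
      using that by (intro SUP_upper) auto
    then have "ereal (of_int (g n)) < ereal (real k)" using k by (rule le_less_trans)
    then show ?thesis by simp
  qed
  then show ?thesis by (rule that)
qed

context graded_valuation
begin

lemma skew_power_class:
  "r_mult W (skew_power_nat \<sigma> u (\<beta> u) i)
     = r_mult W (b powi (- eps.E u i) * \<beta> (of_nat i * u))"
proof (induction i)
  case 0
  show ?case using beta_0 by simp
next
  case (Suc i)
  have "r_mult W (skew_power_nat \<sigma> u (\<beta> u) (Suc i))
      = r_mult W (b powi (- eps.E u i) * \<beta> (of_nat i * u) * \<sigma> (of_nat i * u) (\<beta> u))"
    using r_mult_cong_right[OF Suc] by simp
  also have "\<dots> = r_mult W (b powi (- eps.E u i)
      * (b powi (- \<epsilon> (of_nat i * u) u) * \<beta> (of_nat i * u + u)))"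
    unfolding mult.assoc by (rule r_mult_powi_cong[OF eps])
  also have "\<dots> = r_mult W (b powi (- eps.E u (Suc i)) * \<beta> (of_nat (Suc i) * u))"
    using powi_b_add[of "- eps.E u i" "- \<epsilon> (of_nat i * u) u"]
    by (simp add: eps.sum_Suc mult.assoc algebra_simps)
  finally show ?case .
qed

lemma the_exponent:
  "(THE e. r_mult W (\<beta> (of_nat i * u)) = r_mult W (b powi e * skew_power_nat \<sigma> u (\<beta> u) i))
     = eps.E u i"
proof -
  have "r_mult W (b powi e * skew_power_nat \<sigma> u (\<beta> u) i)
      = r_mult W (b powi (e - eps.E u i) * \<beta> (of_nat i * u))" for e
    using r_mult_powi_cong[OF skew_power_class, of e] powi_b_add[of e "- eps.E u i"]
    by (simp add: mult.assoc)
  moreover have "r_mult W (\<beta> (of_nat i * u)) = r_mult W (b powi e * \<beta> (of_nat i * u)) \<longleftrightarrow> e = 0" for e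
    using powi_b_eq_iff[OF beta_nz[of "of_nat i * u"], of 0 e] by auto
  ultimately show ?thesis by (simp only:) (simp add: the_equality)
qed

text \<open>At \<open>x = M / q\<close> the two maps compute the partial sums of the cocycle along the steps \<open>1 / (n q)\<close> and
\<open>- 1 / (n q)\<close>.\<close>

lemma maps_eq:
  assumes "0 < n" "0 < q" "x * of_nat q = of_nat M"
  shows "g_map \<sigma> b A n q x = eps.E (1 / of_nat (n * q)) (M * n)"
    and "h_map \<sigma> b A n q x = eps.E (- (1 / of_nat (n * q))) (M * n)"
proof -
  have "x * of_nat n * of_nat q = (of_nat (M * n) :: rat)" using assms(3) by (simp add: ac_simps)
  then have floor: "\<lfloor>x * of_nat n * of_nat q\<rfloor> = int (M * n)"
    by (metis floor_of_nat)
  have x: "of_nat (M * n) * (1 / of_nat (n * q)) = x"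
    using assms by (simp add: field_simps)
  show "g_map \<sigma> b A n q x = eps.E (1 / of_nat (n * q)) (M * n)"
    using the_exponent[of "M * n" "1 / of_nat (n * q)"]
    unfolding g_map_def Let_def floor gamma_coeff_def union[symmetric] beta_prod x
    by (simp add: skew_power_def nat_mult_distrib)
  have x': "of_nat (M * n) * (- (1 / of_nat (n * q))) = - x" using x by simp
  show "h_map \<sigma> b A n q x = eps.E (- (1 / of_nat (n * q))) (M * n)"
    using the_exponent[of "M * n" "- (1 / of_nat (n * q))"]
    unfolding h_map_def Let_def floor delta_coeff_def union[symmetric] beta_prod x'
    by (simp add: skew_power_def nat_mult_distrib)
qed

lemma rational_cocycle_uminus: "rational_cocycle (\<lambda>r s. \<epsilon> (- r) (- s))"
proof
  fix r s t
  show "\<epsilon> (- r) (- s) + \<epsilon> (- (r + s)) (- t) = \<epsilon> (- s) (- t) + \<epsilon> (- r) (- (s + t))"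
    using eps.cocycle[of "- r" "- s" "- t"] by simp
qed (simp_all add: eps_bounds)

text \<open>A bound for the second supremum bounds the partial sums of the reflected cocycle
\<open>\<lambda>r s. \<epsilon> (- r) (- s)\<close>, whose splitting is reflected back.\<close>

lemma eps_splits:
  assumes "\<epsilon> s (- s) \<noteq> 0" "0 < m" "l_sup \<sigma> b A m < \<infinity> \<or> k_sup \<sigma> b A m < \<infinity>"
  obtains f where "\<And>r s. f (r + s) = f r + f s + \<epsilon> r s"
proof -
  define q where "q = q_of \<sigma> A m"
  obtain p d where pd: "quotient_of m = (p, d)" by fastforce
  have d: "d > 0" "m = of_int p / of_int d"
    using quotient_of_denom_pos[OF pd] quotient_of_div[OF pd] by auto
  then have p: "p > 0" using assms(2) by (simp add: zero_less_divide_iff)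
  define M where "M = nat p * chosen_l \<sigma> A"
  have q: "q = chosen_l \<sigma> A * nat d" by (simp add: q_def q_of_def pd)
  have pos: "0 < q" "0 < M" using chosen_l_pos[OF assms(1)] d p by (auto simp: q M_def)
  have mq: "m * of_nat q = of_nat M" using d p by (simp add: q M_def)
  note maps = maps_eq[OF _ pos(1) mq]
  from assms(3) show ?thesis
  proof
    assume "l_sup \<sigma> b A m < \<infinity>"
    then obtain C where C: "\<And>n. 1 \<le> n \<Longrightarrow> g_map \<sigma> b A n q m \<le> C"
      unfolding l_sup_def q_def[symmetric] by (rule integer_SUP_bounded) blast
    have bound: "eps.E (1 / of_nat (n * q)) (M * n) \<le> C" if "1 \<le> n" for n
      using C[OF that] maps(1)[of n] that by simp
    show ?thesis by (rule eps.bounded_imp_coboundary[OF pos bound]) (assumption, rule that)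
  next
    assume "k_sup \<sigma> b A m < \<infinity>"
    then obtain C where C: "\<And>n. 1 \<le> n \<Longrightarrow> h_map \<sigma> b A n q m \<le> C"
      unfolding k_sup_def q_def[symmetric] by (rule integer_SUP_bounded) blast
    interpret neg: rational_cocycle "\<lambda>r s. \<epsilon> (- r) (- s)" by (rule rational_cocycle_uminus)
    have E: "neg.E u i = eps.E (- u) i" for u i by (simp add: partial_cocycle_sum_def)
    have bound: "neg.E (1 / of_nat (n * q)) (M * n) \<le> C" if "1 \<le> n" for n
      using C[OF that] maps(2)[of n] that by (simp add: E)
    obtain f where f: "\<And>r s. f (r + s) = f r + f s + \<epsilon> (- r) (- s)"
      by (rule neg.bounded_imp_coboundary[OF pos bound]) (assumption, rule that)
    have "f (- (r + s)) = f (- r) + f (- s) + \<epsilon> r s" for r s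
      using f[of "- r" "- s"] by simp
    then show ?thesis by (rule that[of "\<lambda>r. f (- r)"])
  qed
qed

end

section \<open>Structure of a graded extension of Type (e)\<close>

context graded_valuation
begin

text \<open>Otherwise \<open>A s\<close> would be bounded by \<open>j * \<beta> s\<close>, and the \<open>W\<close>-module that it spans would be smaller
than that of \<open>\<beta> s\<close>.\<close>

lemma nonunits_beta_mem:
  assumes j: "j \<in> nonunits W" shows "j * \<beta> s \<in> A s"
proof (rule ccontr)
  assume notin: "j * \<beta> s \<notin> A s"
  then have jnz: "j \<noteq> 0" by auto
  obtain w x where wx: "w \<in> W" "x \<in> A s" "\<beta> s = w * x" using beta_mem by blast
  have "x * inverse (j * \<beta> s) \<in> W" using A_ratio[OF wx(2) notin] V_subset_W by blast
  then have "w * (x * inverse (j * \<beta> s)) \<in> W" using wx mult by blast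
  moreover have "w * (x * inverse (j * \<beta> s)) = inverse j"
  proof -
    have "w * (x * inverse (j * \<beta> s)) = \<beta> s * inverse (j * \<beta> s)" unfolding wx(3) by (simp add: mult.assoc)
    then show ?thesis using jnz by (simp add: inverse_mult)
  qed
  ultimately show False using j jnz by (simp add: nonunits_def)
qed

lemma not_full_bounds:
  assumes "left_order (A s) \<noteq> W"
  shows "r_mult W (inverse b * \<beta> s) \<subset> A s" "A s \<subset> r_mult W (\<beta> s)"
proof -
  show "A s \<subset> r_mult W (\<beta> s)" using A_subset[of s] assms unfolding A_full[symmetric] psubset_eq by (rule conjI)
  have ib: "inverse b \<in> nonunits W" by (simp add: jac_iff)
  have "r_mult W (inverse b * \<beta> s) \<subseteq> A s"
  proof
    fix z assume "z \<in> r_mult W (inverse b * \<beta> s)"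
    then obtain w where "w \<in> W" "z = w * inverse b * \<beta> s" by (auto simp: r_mult_def mult.assoc)
    moreover have "w * inverse b \<in> nonunits W"
      using left_ideal_nonunits ib \<open>w \<in> W\<close> by (simp add: left_ideal_def)
    ultimately show "z \<in> A s" using nonunits_beta_mem by simp
  qed
  moreover have "A s \<noteq> r_mult W (inverse b * \<beta> s)"
    using left_order_r_mult[of "inverse b * \<beta> s"] assms by auto
  ultimately show "r_mult W (inverse b * \<beta> s) \<subset> A s" by (simp add: psubset_eq)
qed

end

text \<open>The classes of the \<open>\<alpha> r\<close> are a homomorphic section over the rationals, and the \<open>W\<close>-module spanned
by \<open>A r\<close> is that class shifted by \<open>f r\<close> powers of \<open>b\<close>.\<close>

definition factored :: "(rat \<Rightarrow> 'a::division_ring \<Rightarrow> 'a) \<Rightarrow> 'a set \<Rightarrow> 'a \<Rightarrow> (rat \<Rightarrow> 'a set) \<Rightarrow> (rat \<Rightarrow> int) \<Rightarrow> (rat \<Rightarrow> 'a) \<Rightarrow> bool" where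
  "factored \<sigma> W b A f \<alpha> \<longleftrightarrow>
     graded_map UNIV f \<and> (\<exists>r. f r \<noteq> 0) \<and> \<alpha> 0 = 1 \<and>
       (\<forall>r s. set_prod W (A r) = r_mult W (b powi f r * \<alpha> r) \<and>
              r_mult W (\<alpha> r) = l_mult (\<alpha> r) (\<sigma> r ` W) \<and>
              set_prod (r_mult W (\<alpha> r)) (\<sigma> r ` r_mult W (\<alpha> s)) = r_mult W (\<alpha> r * \<sigma> r (\<alpha> s)) \<and>
              r_mult W (\<alpha> r * \<sigma> r (\<alpha> s)) = r_mult W (\<alpha> (r + s)))"

text \<open>How far \<open>A r\<close> may differ from the \<open>W\<close>-module that it spans: only in degree zero, or only on the cyclic
group of degrees in which \<open>f r + f (- r) = 0\<close>.\<close>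

definition homogeneous_parts :: "(rat \<Rightarrow> 'a::division_ring \<Rightarrow> 'a) \<Rightarrow> 'a set \<Rightarrow> 'a set \<Rightarrow> 'a \<Rightarrow> (rat \<Rightarrow> 'a set) \<Rightarrow> (rat \<Rightarrow> int) \<Rightarrow> (rat \<Rightarrow> 'a) \<Rightarrow> bool" where
  "homogeneous_parts \<sigma> V W b A f \<alpha> \<longleftrightarrow>
       (W = V \<or> (\<forall>r. r \<noteq> 0 \<longrightarrow> f r + f (- r) = - 1) \<longrightarrow>
          (\<forall>r. r \<noteq> 0 \<longrightarrow> A r = r_mult W (b powi f r * \<alpha> r))) \<and>
       (W \<noteq> V \<and> (\<exists>k>0. f k + f (- k) = 0) \<longrightarrow>
          (\<exists>k>0. f k + f (- k) = 0 \<and> (\<forall>k'>0. f k' + f (- k') = 0 \<longrightarrow> k \<le> k') \<and>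
             (\<forall>r. r \<notin> multiples k \<longrightarrow> A r = r_mult W (b powi f r * \<alpha> r)) \<and>
             graded_extension (multiples k) \<sigma> V A \<and>
             (\<forall>j::int. r_mult W (b powi (f (of_int j * k) - 1) * \<alpha> (of_int j * k))
                         \<subset> A (of_int j * k) \<and>
                       A (of_int j * k)
                         \<subset> r_mult W (b powi f (of_int j * k) * \<alpha> (of_int j * k)))))"

context graded_valuation
begin

context
  fixes f :: "rat \<Rightarrow> int"
  assumes f: "\<And>r s. f (r + s) = f r + f s + \<epsilon> r s"
begin

text \<open>In degree zero \<open>\<beta> 0\<close> is only known up to a unit of \<open>W\<close>, whereas \<open>\<alpha> 0\<close> has to be \<open>1\<close>.\<close>

definition \<alpha> where "\<alpha> r = (if r = 0 then 1 else b powi (- f r) * \<beta> r)"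

lemma split_0: "f 0 = 0" using f[of 0 0] by simp

lemma split_uminus: "f s + f (- s) = - \<epsilon> s (- s)"
  using f[of s "- s"] split_0 by simp

lemma alpha_class: "r_mult W (\<alpha> r) = r_mult W (b powi (- f r) * \<beta> r)"
  using beta_0 split_0 by (simp add: \<alpha>_def)

lemma alpha_normalizing: "normalizing r (\<alpha> r)"
  by (rule normalizing_cong[OF _ alpha_class])
     (use normalizing_mult[OF normalizing_powi_b beta_normalizing] in simp)

lemma beta_class: "r_mult W (b powi (f r + e) * \<alpha> r) = r_mult W (b powi e * \<beta> r)"
proof -
  have "r_mult W (b powi (f r + e) * \<alpha> r) = r_mult W (b powi (f r + e) * (b powi (- f r) * \<beta> r))"
    by (rule r_mult_powi_cong[OF alpha_class])
  also have "\<dots> = r_mult W (b powi e * \<beta> r)"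
    using powi_b_add[of "f r + e" "- f r"] by (simp add: mult.assoc)
  finally show ?thesis .
qed

lemma alpha_mult: "r_mult W (\<alpha> r * \<sigma> r (\<alpha> s)) = r_mult W (\<alpha> (r + s))"
proof -
  have "r_mult W (\<alpha> r * \<sigma> r (\<alpha> s)) = r_mult W (b powi (- f s) * (\<alpha> r * \<sigma> r (\<beta> s)))"
    by (rule b_shift[OF alpha_normalizing alpha_class])
  also have "\<dots> = r_mult W (b powi (- f s) * (b powi (- f r) * \<beta> r * \<sigma> r (\<beta> s)))"
    by (rule r_mult_powi_cong[OF r_mult_cong_right[OF alpha_class]])
  also have "\<dots> = r_mult W (b powi (- f s - f r) * (\<beta> r * \<sigma> r (\<beta> s)))"
    using powi_b_add[of "- f s" "- f r"] by (simp add: mult.assoc)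
  also have "\<dots> = r_mult W (b powi (- f s - f r) * (b powi (- \<epsilon> r s) * \<beta> (r + s)))"
    by (rule r_mult_powi_cong[OF eps])
  also have "\<dots> = r_mult W (b powi (- f (r + s)) * \<beta> (r + s))"
  proof -
    have "- f (r + s) = - f s - f r + - \<epsilon> r s" using f[of r s] by simp
    then show ?thesis unfolding powi_b_add[symmetric] mult.assoc[symmetric] by (simp only:)
  qed
  finally show ?thesis by (simp add: alpha_class)
qed

lemma split_graded: "graded_map UNIV f"
  unfolding graded_map_def
proof (intro conjI ballI)
  show "f 0 = 0" by (rule split_0)
  show "f s + f t \<le> f (s + t)" for s t using f[of s t] eps_bounds(1)[of s t] by simp
  show "- 1 \<le> f s + f (- s)" for s using split_uminus[of s] eps_bounds(2)[of s "- s"] by simp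
qed

lemma split_factored:
  assumes "\<epsilon> s (- s) \<noteq> 0" shows "factored \<sigma> W b A f \<alpha>"
  unfolding factored_def
proof (intro conjI allI)
  show "\<exists>r. f r \<noteq> 0"
  proof (rule ccontr)
    assume "\<nexists>r. f r \<noteq> 0"
    then show False using split_uminus[of s] assms by simp
  qed
  fix r s
  show "set_prod W (A r) = r_mult W (b powi f r * \<alpha> r)" using beta_class[of r 0] beta_prod by simp
  show "r_mult W (\<alpha> r) = l_mult (\<alpha> r) (\<sigma> r ` W)"
    using normalizing_sets[OF normalizing_nz] alpha_normalizing by blast
  show "set_prod (r_mult W (\<alpha> r)) (\<sigma> r ` r_mult W (\<alpha> s)) = r_mult W (\<alpha> r * \<sigma> r (\<alpha> s))"
    by (rule set_prod_normalizing[OF alpha_normalizing])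
qed (simp_all add: split_graded \<alpha>_def[of 0] alpha_mult)

text \<open>For \<open>W \<noteq> V\<close> the invertible degrees of \<open>f\<close> are exactly those in which \<open>A r\<close> is not a \<open>W\<close>-module, and
for a nonzero graded map they are cyclic.\<close>

lemma split_parts:
  assumes "\<epsilon> s (- s) \<noteq> 0" shows "homogeneous_parts \<sigma> V W b A f \<alpha>"
  unfolding homogeneous_parts_def
proof (intro conjI impI)
  have full: "A r = r_mult W (b powi f r * \<alpha> r)" if "left_order (A r) = W" for r
    using that beta_class[of r 0] unfolding A_full[symmetric] by simp
  {
    assume "W = V \<or> (\<forall>r. r \<noteq> 0 \<longrightarrow> f r + f (- r) = - 1)"
    then have "left_order (A r) = W" if "r \<noteq> 0" for r
    proof
      assume "\<forall>r. r \<noteq> 0 \<longrightarrow> f r + f (- r) = - 1"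
      then have "\<epsilon> r (- r) \<noteq> 0" using that split_uminus[of r] by simp
      then show ?thesis using eps_not_full[of r] by (rule contrapos_np)
    qed (rule all_full)
    then show "\<forall>r. r \<noteq> 0 \<longrightarrow> A r = r_mult W (b powi f r * \<alpha> r)" using full by simp
  }
  assume asm: "W \<noteq> V \<and> (\<exists>k>0. f k + f (- k) = 0)"
  interpret graded_mapping f by standard (rule split_graded)
  have degrees_iff: "r \<in> invertible_degrees \<longleftrightarrow> left_order (A r) \<noteq> W" for r
  proof -
    have "r \<in> invertible_degrees \<longleftrightarrow> \<epsilon> r (- r) = 0" using split_uminus[of r] by (simp add: invertible_degrees_def)
    also have "\<dots> \<longleftrightarrow> left_order (A r) \<noteq> W"
      using eps_not_full[of r] eps_full[OF _ conjunct1[OF asm], of r] by linarith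
    finally show ?thesis .
  qed
  have "f s \<noteq> 0 \<or> f (- s) \<noteq> 0" using split_uminus[of s] assms by auto
  then obtain r where r: "f r \<noteq> 0" by blast
  obtain k0 where k0: "0 < k0" "k0 \<in> invertible_degrees" using asm by (auto simp: invertible_degrees_def)
  obtain k where k: "k > 0" "k \<in> invertible_degrees" "\<And>k'. k' > 0 \<Longrightarrow> k' \<in> invertible_degrees \<Longrightarrow> k \<le> k'"
    by (rule least_period[OF r k0(2,1)]) (rule that, blast+)
  have degrees_eq: "invertible_degrees = multiples k" by (rule invertible_degrees_eq_multiples) (fact k)+
  show "\<exists>k>0. f k + f (- k) = 0 \<and> (\<forall>k'>0. f k' + f (- k') = 0 \<longrightarrow> k \<le> k') \<and>
             (\<forall>r. r \<notin> multiples k \<longrightarrow> A r = r_mult W (b powi f r * \<alpha> r)) \<and>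
             graded_extension (multiples k) \<sigma> V A \<and>
             (\<forall>j::int. r_mult W (b powi (f (of_int j * k) - 1) * \<alpha> (of_int j * k))
                         \<subset> A (of_int j * k) \<and>
                       A (of_int j * k)
                         \<subset> r_mult W (b powi f (of_int j * k) * \<alpha> (of_int j * k)))"
  proof (intro exI[of _ k] conjI allI impI)
    show "graded_extension (multiples k) \<sigma> V A"
      unfolding graded_extension_multiples by (rule graded_family_subset[OF family])
    show "A r = r_mult W (b powi f r * \<alpha> r)" if "r \<notin> multiples k" for r
    proof -
      from that have "r \<notin> invertible_degrees" by (simp add: degrees_eq)
      then show ?thesis using full degrees_iff by simp
    qed
    fix j :: int
    have "of_int j * k \<in> invertible_degrees" unfolding degrees_eq multiples_def by (rule rangeI)
    then have nf: "left_order (A (of_int j * k)) \<noteq> W" by (simp add: degrees_iff)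
    show "r_mult W (b powi (f (of_int j * k) - 1) * \<alpha> (of_int j * k)) \<subset> A (of_int j * k)"
      using not_full_bounds(1)[OF nf] beta_class[of "of_int j * k" "- 1"] by (simp add: power_int_minus)
    show "A (of_int j * k) \<subset> r_mult W (b powi f (of_int j * k) * \<alpha> (of_int j * k))"
      using not_full_bounds(2)[OF nf] beta_class[of "of_int j * k" 0] by simp
  qed (use k in \<open>auto simp: invertible_degrees_def\<close>)
qed

end

theorem type_e_imp_factored:
  assumes "type_II (multiples r) \<sigma> V A"
    and "0 < m" "l_sup \<sigma> b A m < \<infinity> \<or> k_sup \<sigma> b A m < \<infinity>"
  shows "\<exists>f \<alpha>. factored \<sigma> W b A f \<alpha> \<and> homogeneous_parts \<sigma> V W b A f \<alpha>"
proof -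
  obtain s where s: "\<epsilon> s (- s) \<noteq> 0" using eps_nonzero[OF assms(1)] .
  obtain f where f: "\<And>r s. f (r + s) = f r + f s + \<epsilon> r s" by (rule eps_splits[OF s assms(2,3)]) blast
  show ?thesis by (intro exI conjI) (rule split_factored[OF f s], rule split_parts[OF f s])
qed

end

section \<open>Construction of graded extensions of Type (e)\<close>

locale factored_family = principal_valuation \<sigma> W b + V: valuation V
  for \<sigma> :: "rat \<Rightarrow> 'a::division_ring \<Rightarrow> 'a" and W :: "'a set" and b :: 'a and V :: "'a set" +
  fixes A :: "rat \<Rightarrow> 'a set" and f :: "rat \<Rightarrow> int" and \<alpha> :: "rat \<Rightarrow> 'a"
  assumes additive: "additive_subgrp (A r)"
    and A_0: "A 0 = V" and V_subset_W: "V \<subseteq> W"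
    and factored: "factored \<sigma> W b A f \<alpha>"
    and parts: "homogeneous_parts \<sigma> V W b A f \<alpha>"
begin

lemma alpha_0: "\<alpha> 0 = 1"
  and f_nonzero: "\<exists>r. f r \<noteq> 0"
  and prod_W: "set_prod W (A r) = r_mult W (b powi f r * \<alpha> r)"
  and alpha_mult: "r_mult W (\<alpha> r * \<sigma> r (\<alpha> s)) = r_mult W (\<alpha> (r + s))"
  using factored unfolding factored_def by blast+

sublocale graded_mapping f
  by standard (use factored in \<open>simp add: factored_def\<close>)

lemma alpha_nz [simp]: "\<alpha> r \<noteq> 0"
proof
  assume "\<alpha> r = 0"
  then show False using r_mult_zero_eq[OF alpha_mult[of r "- r"]] alpha_0 by simp
qed

lemma alpha_normalizing: "normalizing r (\<alpha> r)"
  using factored unfolding normalizing_sets[OF alpha_nz] factored_def by blast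

lemma factor_normalizing: "normalizing r (b powi e * \<alpha> r)"
  using normalizing_mult[OF normalizing_powi_b alpha_normalizing] by simp

lemma factor_mult:
  "r_mult W (b powi e * \<alpha> r * \<sigma> r (b powi e' * \<alpha> s)) = r_mult W (b powi (e + e') * \<alpha> (r + s))"
proof -
  have "r_mult W (b powi e * \<alpha> r * \<sigma> r (b powi e' * \<alpha> s))
      = r_mult W (b powi e' * (b powi e * \<alpha> r * \<sigma> r (\<alpha> s)))"
    by (rule b_shift[OF factor_normalizing refl])
  also have "\<dots> = r_mult W (b powi (e + e') * (\<alpha> r * \<sigma> r (\<alpha> s)))"
    using powi_b_add[of e' e] by (simp add: mult.assoc add.commute)
  also have "\<dots> = r_mult W (b powi (e + e') * \<alpha> (r + s))"
    by (rule r_mult_powi_cong[OF alpha_mult])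
  finally show ?thesis .
qed

lemma factor_mem_mult:
  assumes "x \<in> r_mult W (b powi e * \<alpha> r)" "y \<in> r_mult W (b powi e' * \<alpha> s)"
  shows "x * \<sigma> r y \<in> r_mult W (b powi (e + e') * \<alpha> (r + s))"
proof -
  obtain w where w: "w \<in> W" "x = w * (b powi e * \<alpha> r)" using assms(1) by (auto simp: r_mult_def)
  have "b powi e * \<alpha> r * \<sigma> r y \<in> r_mult W (b powi e * \<alpha> r * \<sigma> r (b powi e' * \<alpha> s))"
    by (subst normalizing_mult_mem[OF factor_normalizing]) (use assms(2) in simp_all)
  then show ?thesis using W_r_mult[OF w(1)] unfolding factor_mult w(2) by (simp add: mult.assoc)
qed

lemma factor_dual:
  assumes "x \<notin> r_mult W (b powi e * \<alpha> r)" "x \<noteq> 0"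
  shows "\<sigma> (- r) (inverse x) \<in> r_mult W (b powi (- e - 1) * \<alpha> (- r))"
proof -
  let ?n = "b powi e * \<alpha> r"
  have "x * inverse ?n \<notin> W" using assms(1) by (simp add: r_mult_iff)
  then have "?n * inverse x \<in> nonunits W" using nonunitsI assms(2) by (fastforce simp: inverse_mult)
  then have "?n * inverse x \<in> r_mult W (inverse b)" by (simp add: r_mult_iff jac_iff)
  also have "r_mult W (inverse b) = r_mult W (?n * \<sigma> r (b powi (- e - 1) * \<alpha> (- r)))"
    unfolding factor_mult by (simp add: alpha_0 power_int_minus)
  finally have "?n * \<sigma> r (\<sigma> (- r) (inverse x)) \<in> \<dots>" by simp
  then show ?thesis by (subst (asm) normalizing_mult_mem[OF factor_normalizing]) simp_all
qed

lemma A_subset: "A r \<subseteq> r_mult W (b powi f r * \<alpha> r)"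
  unfolding prod_W[symmetric] using set_prod_inc[OF one] by (metis mult_1 subsetI)

lemma nonunits_subset_V: "nonunits W \<subseteq> V"
proof
  fix x assume x: "x \<in> nonunits W"
  then show "x \<in> V" using V.total[of x] V_subset_W by (cases "x = 0") (auto simp: nonunits_def)
qed

text \<open>It suffices to control the components over a subgroup \<open>T\<close> and the products of two degrees outside
\<open>T\<close> that fall into \<open>T\<close>. Degrees outside \<open>T\<close> obey the multiplication of the \<open>\<alpha> r\<close> and the
superadditivity of \<open>f\<close>; that \<open>f\<close> loses at most one on opposite degrees gives the valuation property
there.\<close>

lemma family_from_subgroup:
  assumes T: "0 \<in> T" "\<And>r. r \<in> T \<Longrightarrow> - r \<in> T" "\<And>r s. r \<in> T \<Longrightarrow> s \<in> T \<Longrightarrow> r + s \<in> T"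
    and fam: "graded_family T V A"
    and full: "\<And>r. r \<notin> T \<Longrightarrow> A r = r_mult W (b powi f r * \<alpha> r)"
    and cross: "\<And>r s. r \<notin> T \<Longrightarrow> s \<notin> T \<Longrightarrow> r + s \<in> T \<Longrightarrow>
                  r_mult W (b powi (f r + f s) * \<alpha> (r + s)) \<subseteq> A (r + s)"
  shows "graded_family UNIV V A"
  unfolding graded_family_def
proof (intro conjI ballI allI impI)
  show "1 \<in> A 0" by (simp add: A_0)
  fix r s x y assume xy: "x \<in> A r" "y \<in> A s"
  have prod: "x * \<sigma> r y \<in> r_mult W (b powi (f r + f s) * \<alpha> (r + s))"
    using xy A_subset factor_mem_mult by blast
  show "x * \<sigma> r y \<in> A (r + s)"
  proof (cases "r + s \<in> T")
    case False
    have "r_mult W (b powi (f r + f s) * \<alpha> (r + s)) \<subseteq> A (r + s)"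
      unfolding full[OF False] using powi_b_subset_iff[OF alpha_nz] superadd by simp
    then show ?thesis using prod by blast
  next
    case True
    consider "r \<in> T" "s \<in> T" | "r \<notin> T" "s \<notin> T"
      using T(3)[OF True T(2), of s] T(3)[OF T(2) True, of r] by (cases "r \<in> T"; cases "s \<in> T") auto
    then show ?thesis
    proof cases
      case 1
      then show ?thesis using fam xy by (simp add: graded_family_def)
    next
      case 2
      then show ?thesis using cross[OF 2 True] prod by blast
    qed
  qed
next
  fix r x assume x: "x \<noteq> (0::'a)"
  show "x \<in> A r \<or> \<sigma> (- r) (inverse x) \<in> A (- r)"
  proof (cases "r \<in> T")
    case True
    then show ?thesis using fam x unfolding graded_family_def by blast
  next
    case False
    then have "- r \<notin> T" using T(2)[of "- r"] by auto
    then have "r_mult W (b powi (- f r - 1) * \<alpha> (- r)) \<subseteq> A (- r)"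
      using full[of "- r"] powi_b_subset_iff[OF alpha_nz] sym_lower[of r] by simp
    then show ?thesis using factor_dual[of x "f r" r] x full[OF False] by blast
  qed
qed (simp_all add: additive A_0)

text \<open>In the first case \<open>T\<close> is the zero subgroup. In the second case it is the cyclic group of invertible
degrees; if \<open>r\<close> and \<open>s\<close> lie outside and \<open>r + s\<close> inside, then \<open>f r + f s = f (r + s) - 1\<close>, so the product
lands in the part \<open>r_mult W (b powi (f (r + s) - 1) * \<alpha> (r + s))\<close> that \<open>A (r + s)\<close> contains.\<close>

lemma graded_family: "graded_family UNIV V A"
proof (cases "W = V \<or> (\<forall>r. r \<noteq> 0 \<longrightarrow> f r + f (- r) = - 1)")
  case True
  then have full: "A r = r_mult W (b powi f r * \<alpha> r)" if "r \<noteq> 0" for r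
    using parts that unfolding homogeneous_parts_def by blast
  show ?thesis
  proof (rule family_from_subgroup[of "{0}"])
    show "graded_family {0} V A"
      using additive[of 0] V.mult V.total by (auto simp: graded_family_def A_0)
    fix r s :: rat assume rs: "r \<notin> {0}" "s \<notin> {0}" "r + s \<in> {0}"
    then have s: "s = - r" by (simp add: add_eq_0_iff)
    have "r_mult W (b powi (f r + f (- r))) \<subseteq> V" using True
    proof
      assume "W = V"
      then show ?thesis
        using powi_b_subset_iff[of 1 "f r + f (- r)" 0] sym_upper[of r] by simp
    next
      assume "\<forall>r. r \<noteq> 0 \<longrightarrow> f r + f (- r) = - 1"
      then have "f r + f (- r) = - 1" using rs by simp
      then have "r_mult W (b powi (f r + f (- r))) = nonunits W"
        by (simp add: power_int_minus jac[symmetric] jacobson_eq_nonunits)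
      then show ?thesis using nonunits_subset_V by simp
    qed
    then show "r_mult W (b powi (f r + f s) * \<alpha> (r + s)) \<subseteq> A (r + s)"
      by (simp add: s alpha_0 A_0)
  qed (use full in auto)
next
  case False
  then obtain r0 where r0: "r0 \<noteq> 0" "f r0 + f (- r0) = 0" using sym_cases by blast
  then have "0 < \<bar>r0\<bar>" "f \<bar>r0\<bar> + f (- \<bar>r0\<bar>) = 0" by (auto simp: abs_if add.commute)
  then obtain k where k: "k > 0" "f k + f (- k) = 0" "\<forall>k'>0. f k' + f (- k') = 0 \<longrightarrow> k \<le> k'"
      and full: "\<forall>r. r \<notin> multiples k \<longrightarrow> A r = r_mult W (b powi f r * \<alpha> r)"
      and ext: "graded_extension (multiples k) \<sigma> V A"
      and lower: "\<forall>j::int. r_mult W (b powi (f (of_int j * k) - 1) * \<alpha> (of_int j * k)) \<subset> A (of_int j * k)"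
    using parts False unfolding homogeneous_parts_def by (metis (no_types, lifting))
  have degrees_eq: "invertible_degrees = multiples k" by (rule invertible_degrees_eq_multiples) (use k in \<open>auto simp: invertible_degrees_def\<close>)
  show ?thesis
  proof (rule family_from_subgroup[of "multiples k"])
    show "graded_family (multiples k) V A" using ext by (simp add: graded_extension_multiples)
    fix r s assume rs: "r \<notin> multiples k" "s \<notin> multiples k" "r + s \<in> multiples k"
    have "f (r + s + - r) = f (r + s) + f (- r)" using additive_on_invertible rs(3) degrees_eq by blast
    moreover have "f r + f (- r) = - 1" using rs(1) sym_cases[of r] by (auto simp: degrees_eq[symmetric] invertible_degrees_def)
    ultimately have "f r + f s \<le> f (r + s) - 1" by simp
    then have "r_mult W (b powi (f r + f s) * \<alpha> (r + s)) \<subseteq> r_mult W (b powi (f (r + s) - 1) * \<alpha> (r + s))"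
      by (simp add: powi_b_subset_iff)
    also obtain j where "r + s = of_int j * k" using rs(3) by (auto simp: multiples_def)
    then have "r_mult W (b powi (f (r + s) - 1) * \<alpha> (r + s)) \<subseteq> A (r + s)" using lower by auto
    finally show "r_mult W (b powi (f r + f s) * \<alpha> (r + s)) \<subseteq> A (r + s)" .
  qed (use full multiples_group in auto)
qed

text \<open>Multiplying an exact product of components by \<open>W\<close> gives an exact product of the spanned
\<open>W\<close>-modules.\<close>

lemma set_prod_eq_imp_additive:
  assumes "set_prod (A g) (\<sigma> g ` A h) = A (g + h)" shows "f g + f h = f (g + h)"
proof -
  let ?L = "r_mult W (b powi (f g + f h) * \<alpha> (g + h))"
  have add: "additive_subgrp ?L" by (intro additive_subgrp_r_mult add_sub)
  have "A (g + h) \<subseteq> ?L"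
    unfolding assms[symmetric]
  proof (rule set_prod_minimal[OF add])
    fix x y assume "x \<in> A g" "y \<in> \<sigma> g ` A h"
    then show "x * y \<in> ?L" using factor_mem_mult A_subset by (elim imageE) blast
  qed
  then have "set_prod W (A (g + h)) \<subseteq> ?L"
    by (intro set_prod_minimal[OF add] W_r_mult) auto
  then have "f (g + h) \<le> f g + f h" unfolding prod_W by (simp add: powi_b_subset_iff)
  then show ?thesis using superadd[of g h] by simp
qed

lemma multiples_common:
  assumes "0 < g" "0 < h" obtains r :: rat where "0 < r" "g \<in> multiples r" "h \<in> multiples r"
proof -
  obtain p d where pd: "g = of_int p / of_int d" "d > 0"
    using quotient_of_div[of g] quotient_of_denom_pos[of g] by (metis surj_pair)
  obtain p' d' where pd': "h = of_int p' / of_int d'" "d' > 0"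
    using quotient_of_div[of h] quotient_of_denom_pos[of h] by (metis surj_pair)
  have "g = of_int (p * d') * (1 / of_int (d * d'))" "h = of_int (p' * d) * (1 / of_int (d * d'))"
    using pd pd' by simp_all
  then have "g \<in> multiples (1 / of_int (d * d'))" "h \<in> multiples (1 / of_int (d * d'))"
    unfolding multiples_def by blast+
  then show ?thesis by (rule that[rotated]) (use pd pd' in simp)
qed

text \<open>Otherwise all products of two positive, and of two negative, degrees would be exact, and \<open>f\<close> would be
additive on each half line and therefore zero.\<close>

lemma type_II: "\<exists>r>0. type_II (multiples r) \<sigma> V A"
proof -
  obtain r0 where "f r0 \<noteq> 0" using f_nonzero by blast
  then obtain g h where gh: "0 < g" "0 < h" "f g + f h \<noteq> f (g + h) \<or> f (- g) + f (- h) \<noteq> f (- g - h)"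
    using not_additive by blast
  obtain r where r: "0 < r" "g \<in> multiples r" "h \<in> multiples r" using multiples_common[OF gh(1,2)] .
  have "set_prod (A g) (\<sigma> g ` A h) \<noteq> A (g + h) \<or>
         set_prod (A (- g)) (\<sigma> (- g) ` A (- h)) \<noteq> A (- g - h)"
    using gh(3) set_prod_eq_imp_additive[of g h] set_prod_eq_imp_additive[of "- g" "- h"] by auto
  then have "type_II (multiples r) \<sigma> V A"
    unfolding type_II_def graded_extension_multiples
    using graded_family_subset[OF graded_family] r(2,3) gh(1,2) by blast
  then show ?thesis using r(1) by blast
qed

end

theorem theorem4p14:
  fixes \<sigma> :: "rat \<Rightarrow> 'a::division_ring \<Rightarrow> 'a"
    and V W :: "'a set" and A :: "rat \<Rightarrow> 'a set" and b :: 'a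
  assumes "rat_action \<sigma>"
    and "total_valuation_ring V" and "V \<noteq> UNIV"
    and "additive_subgroup (graded_sum UNIV \<sigma> A) (skew_group_ring UNIV \<sigma>)"
    and "A 0 = V"
    and "W = union_ring A" and "is_subring W"
    and "b \<noteq> 0" and "jacobson W = r_mult W (inverse b)"
    and "\<exists>t. left_order (A t) = W"
    and "type_e \<sigma> V A \<Longrightarrow> \<exists>m>0. l_sup \<sigma> b A m < \<infinity> \<or> k_sup \<sigma> b A m < \<infinity>"
  shows "type_e \<sigma> V A \<longleftrightarrow>
    (\<exists>(f :: rat \<Rightarrow> int) (\<alpha> :: rat \<Rightarrow> 'a).
       graded_map UNIV f \<and> (\<exists>r. f r \<noteq> 0) \<and> \<alpha> 0 = 1 \<and>
       (\<forall>r s. set_prod W (A r) = r_mult W (b powi f r * \<alpha> r) \<and>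
              r_mult W (\<alpha> r) = l_mult (\<alpha> r) (\<sigma> r ` W) \<and>
              set_prod (r_mult W (\<alpha> r)) (\<sigma> r ` r_mult W (\<alpha> s)) = r_mult W (\<alpha> r * \<sigma> r (\<alpha> s)) \<and>
              r_mult W (\<alpha> r * \<sigma> r (\<alpha> s)) = r_mult W (\<alpha> (r + s))) \<and>
       (W = V \<or> (\<forall>r. r \<noteq> 0 \<longrightarrow> f r + f (- r) = - 1) \<longrightarrow>
          (\<forall>r. r \<noteq> 0 \<longrightarrow> A r = r_mult W (b powi f r * \<alpha> r))) \<and>
       (W \<noteq> V \<and> (\<exists>k>0. f k + f (- k) = 0) \<longrightarrow>
          (\<exists>k>0. f k + f (- k) = 0 \<and> (\<forall>k'>0. f k' + f (- k') = 0 \<longrightarrow> k \<le> k') \<and>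
             (\<forall>r. r \<notin> multiples k \<longrightarrow> A r = r_mult W (b powi f r * \<alpha> r)) \<and>
             graded_extension (multiples k) \<sigma> V A \<and>
             (\<forall>j::int. r_mult W (b powi (f (of_int j * k) - 1) * \<alpha> (of_int j * k))
                         \<subset> A (of_int j * k) \<and>
                       A (of_int j * k)
                         \<subset> r_mult W (b powi f (of_int j * k) * \<alpha> (of_int j * k))))))"
proof -
  interpret V: valuation V by standard (fact assms(2))
  have "V \<subseteq> left_order (A 0)" using V.mult by (auto simp: mem_left_order assms(5))
  then have VW: "V \<subseteq> W" using assms(6) by (auto simp: union_ring_def)
  have "total_valuation_ring W"
    using assms(7) V.total VW unfolding total_valuation_ring_def by blast
  then interpret principal_valuation \<sigma> W b
    by unfold_locales (use assms in simp_all)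
  have "type_e \<sigma> V A \<longleftrightarrow> (\<exists>f \<alpha>. factored \<sigma> W b A f \<alpha> \<and> homogeneous_parts \<sigma> V W b A f \<alpha>)"
  proof
    assume e: "type_e \<sigma> V A"
    interpret graded_valuation \<sigma> W b V A
      by unfold_locales (use e assms in \<open>simp_all add: type_e_def graded_extension_UNIV\<close>)
    obtain r where "type_II (multiples r) \<sigma> V A" using e by (auto simp: type_e_def)
    moreover obtain m where "0 < m" "l_sup \<sigma> b A m < \<infinity> \<or> k_sup \<sigma> b A m < \<infinity>"
      using assms(11)[OF e] by blast
    ultimately show "\<exists>f \<alpha>. factored \<sigma> W b A f \<alpha> \<and> homogeneous_parts \<sigma> V W b A f \<alpha>"
      by (rule type_e_imp_factored)
  next
    assume "\<exists>f \<alpha>. factored \<sigma> W b A f \<alpha> \<and> homogeneous_parts \<sigma> V W b A f \<alpha>"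
    then obtain f \<alpha> where "factored \<sigma> W b A f \<alpha>" "homogeneous_parts \<sigma> V W b A f \<alpha>" by blast
    then interpret factored_family \<sigma> W b V A f \<alpha>
      using graded_sum_additive[OF additive_subgroup.a_subgroup[OF assms(4)]] assms(5) VW
      by unfold_locales simp_all
    show "type_e \<sigma> V A"
      unfolding type_e_def assms(6)[symmetric] graded_extension_UNIV
      using graded_family type_II assms(7) jac_left b_nz by blast
  qed
  then show ?thesis
    by (simp only: factored_def homogeneous_parts_def conj_assoc)
qed

end
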